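(* Let $X(i\mathbb{R})$ be the family of functions $i\mathbb{R}\to\mathbb{C}$ that are uniform limits on $i\mathbb{R}$ of sequences of Dirichlet polynomials. Then $\varphi\in X(i\mathbb{R})$ if and only if there exists a function $f\in\mathcal{A}(\mathbb{C}_+)$ such that $$\varphi(i\tau)=\lim_{\sigma\to 0^+}f(\sigma+i\tau),\qquad -\infty<\tau<+\infty.$$
   Context: A Dirichlet polynomial is a function $P(s)=\sum_{n=1}^{N}a_n\frac{1}{n^s}$ with $N\in\mathbb{N}$, $a_n\in\mathbb{C}$. $\mathbb{C}_+=\{s\in\mathbb{C}:\operatorname{Re} s>0\}$. $\mathcal{A}(\mathbb{C}_+)$ is the set of all Dirichlet series $\sum_{n=1}^{\infty}\frac{a_n}{n^s}$ ($a_n\in\mathbb{C}$) which are convergent at every point of $\mathbb{C}_+$ and define a uniformly continuous function on $\mathbb{C}_+$ (identified with that function). *)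

theory Defs
  imports "HOL-Analysis.Analysis"
begin

text \<open>
  A function on a subset \<open>S\<close> of the plane is rendered as a total function \<open>complex \<Rightarrow> complex\<close> of which
  only the values on \<open>S\<close> are used: both families below are closed under changing a member off \<open>S\<close>.
\<close>

definition imaginary_axis :: "complex set" where
  "imaginary_axis = {s. Re s = 0}"

definition right_half_plane :: "complex set" where
  "right_half_plane = {s. Re s > 0}"

definition dirichlet_polynomial :: "(complex \<Rightarrow> complex) \<Rightarrow> bool" where
  "dirichlet_polynomial P \<longleftrightarrow>
     (\<exists>(N::nat) (a :: nat \<Rightarrow> complex). P = (\<lambda>s. \<Sum>n=1..N. a n * (1 / of_nat n powr s)))"

definition X_imaginary_axis :: "(complex \<Rightarrow> complex) set" where
  "X_imaginary_axis =
     {\<phi>. \<exists>P :: nat \<Rightarrow> complex \<Rightarrow> complex.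
          (\<forall>k. dirichlet_polynomial (P k)) \<and> uniform_limit imaginary_axis P \<phi> sequentially}"

text \<open>
  \<open>sums\<close> is convergence of the partial sums in the given order, so convergence may be conditional;
  the shift by \<open>Suc\<close> makes the series start at \<open>n = 1\<close>.
\<close>

definition A_right_half_plane :: "(complex \<Rightarrow> complex) set" where
  "A_right_half_plane =
     {f. (\<exists>a :: nat \<Rightarrow> complex. \<forall>s\<in>right_half_plane.
            (\<lambda>n. a (Suc n) / of_nat (Suc n) powr s) sums f s) \<and>
         uniformly_continuous_on right_half_plane f}"

end

theory Submission
  imports Defs "HOL-Complex_Analysis.Conformal_Mappings"
begin

text \<open>
  Both directions rest on a quantitative form of Bohr's theorem on uniform convergence of Dirichlet
  series: if a Dirichlet series converges on a vertical line to a sum bounded by \<open>M\<close>, and its partial sums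
  grow sublinearly along that line, uniformly in their length, then the \<open>N\<close>-th partial sums there
  are at most \<open>M\<close> times a constant times \<open>N powr \<epsilon>\<close>, for every \<open>\<epsilon> > 0\<close>
  (\<open>bohr_partial_sum_bound\<close>). It is proved by integrating the sum function against an even kernel whose
  Fourier transform is a trapezoid that equals a constant up to \<open>ln N\<close> and 0 from \<open>ln (N + 1)\<close> on. Such an
  integral picks out exactly the first \<open>N\<close> terms, and the normalized kernel has \<open>L\<^sup>1\<close> norm
  at most of order \<open>N powr \<epsilon>\<close>. Summation by parts (\<open>uniform_tail_bound\<close>) turns such a bound on partial sums into
  convergence on every line further to the right, since \<open>\<epsilon>\<close> is arbitrary, with a rate that depends on
  nothing but \<open>M\<close>, \<open>\<epsilon>\<close> and the distance of the lines.

  Let \<open>\<phi>\<close> be a uniform limit of Dirichlet polynomials on the imaginary axis. The maximum principle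
  (\<open>dirichlet_sum_maximum_principle\<close>) extends the convergence to the closed right half-plane, where the limit
  \<open>f\<close> is uniformly continuous and has boundary values \<open>\<phi>\<close>. What is left is that \<open>f\<close> is the sum
  of a convergent Dirichlet series. Bohr's estimate for differences of the polynomials makes the
  coefficients converge and bounds the partial sums of polynomial minus limit series by a
  small multiple of \<open>N powr \<epsilon>\<close>; after summation by parts, the series converges and its sum is \<open>f\<close>.

  Conversely, let \<open>f\<close> be a uniformly continuous sum of a Dirichlet series on the open half-plane. Then
  \<open>f\<close> tends to its boundary values uniformly along horizontal lines, so it suffices to approximate \<open>f\<close>
  uniformly on each line \<open>Re s = \<sigma> > 0\<close> by partial sums. Uniform continuity and absolute convergence
  on \<open>Re s = 2\<close> make \<open>f\<close> bounded on \<open>0 < Re s \<le> 2\<close> (\<open>A_right_half_plane_bounded\<close>), and Bohr's estimate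
  applies on lines closer to the boundary. There the series may converge only conditionally, which is where
  the growth of its partial sums along the line has to be controlled (\<open>dirichlet_sum_growth\<close>).
\<close>

section \<open>Dirichlet sums and summation by parts\<close>

text \<open>
  The index is shifted so that all sums start at 0. The exponential form makes analyticity in \<open>s\<close> and
  the mean value estimates immediate.
\<close>

definition inv_pow :: "nat \<Rightarrow> complex \<Rightarrow> complex" where
  "inv_pow n s = exp (- s * of_real (ln (real (Suc n))))"

definition dirichlet_sum :: "(nat \<Rightarrow> complex) \<Rightarrow> nat \<Rightarrow> complex \<Rightarrow> complex" where
  "dirichlet_sum b N s = (\<Sum>n<N. b n * inv_pow n s)"

lemma inv_pow_eq_powr: "inv_pow n s = 1 / of_nat (Suc n) powr s"
proof -
  have "of_nat (Suc n) powr s = exp (s * of_real (ln (real (Suc n))))"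
    by (simp add: powr_def Ln_of_nat del: of_nat_Suc)
  then show ?thesis
    by (simp add: inv_pow_def exp_minus inverse_eq_divide del: of_nat_Suc)
qed

lemma norm_inv_pow: "norm (inv_pow n s) = real (Suc n) powr (- Re s)"
  by (simp add: inv_pow_def norm_exp_eq_Re powr_def del: of_nat_Suc)

lemma inv_pow_add: "inv_pow n (s + w) = inv_pow n s * inv_pow n w"
  by (simp add: inv_pow_def exp_add [symmetric] algebra_simps del: of_nat_Suc)

lemma inv_pow_zero [simp]: "inv_pow n 0 = 1"
  by (simp add: inv_pow_def)

lemma norm_inv_pow_le_1: "0 \<le> Re s \<Longrightarrow> norm (inv_pow n s) \<le> 1"
  using powr_mono [of "- Re s" 0 "real (Suc n)"] by (simp add: norm_inv_pow)

lemma holomorphic_inv_pow: "inv_pow n holomorphic_on A"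
  unfolding inv_pow_def [abs_def] by (intro holomorphic_intros)

lemma holomorphic_dirichlet_sum: "dirichlet_sum b N holomorphic_on A"
  unfolding dirichlet_sum_def [abs_def] by (intro holomorphic_intros holomorphic_inv_pow)

lemma dirichlet_sum_0 [simp]: "dirichlet_sum b 0 s = 0"
  by (simp add: dirichlet_sum_def)

lemma dirichlet_sum_Suc: "dirichlet_sum b (Suc N) s = dirichlet_sum b N s + b N * inv_pow N s"
  by (simp add: dirichlet_sum_def)

lemma dirichlet_sum_diff: "dirichlet_sum (\<lambda>n. b n - c n) N s = dirichlet_sum b N s - dirichlet_sum c N s"
  by (simp add: dirichlet_sum_def sum_subtractf algebra_simps)

lemma dirichlet_sum_add_arg: "dirichlet_sum b N (s + w) = (\<Sum>n<N. (b n * inv_pow n s) * inv_pow n w)"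
  by (simp add: dirichlet_sum_def inv_pow_add mult.assoc)

lemma dirichlet_sum_stable:
  assumes "\<And>n. L \<le> n \<Longrightarrow> b n = 0" "L \<le> N"
  shows "dirichlet_sum b N s = dirichlet_sum b L s"
  unfolding dirichlet_sum_def using assms by (intro sum.mono_neutral_right) auto

lemma norm_dirichlet_sum_le:
  assumes "0 \<le> Re s"
  shows "norm (dirichlet_sum b N s) \<le> (\<Sum>n<N. norm (b n))"
  unfolding dirichlet_sum_def
proof (rule sum_norm_le)
  fix n
  show "norm (b n * inv_pow n s) \<le> norm (b n)"
    using norm_inv_pow_le_1 [OF assms, of n] by (simp add: norm_mult mult_left_le)
qed

text \<open>
  The exponential has derivative of modulus at most \<open>exp r\<close> on the convex set \<open>Re z \<le> r\<close>. This one mean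
  value estimate serves twice: for varying \<open>s\<close> with \<open>n\<close> fixed, and for passing from \<open>n\<close> to \<open>n + 1\<close>.
\<close>

lemma norm_exp_diff_le:
  fixes u v :: complex
  assumes "Re u \<le> r" "Re v \<le> r"
  shows "norm (exp u - exp v) \<le> exp r * norm (u - v)"
proof (rule field_differentiable_bound)
  show "convex {z. Re z \<le> r}" by (rule convex_halfspace_Re_le)
  show "(exp has_field_derivative exp z) (at z within {z. Re z \<le> r})" for z :: complex
    by (rule DERIV_subset [OF DERIV_exp]) simp
qed (use assms in \<open>auto simp: norm_exp_eq_Re\<close>)

lemma norm_inv_pow_diff_arg_le:
  assumes "0 \<le> Re s" "0 \<le> Re w"
  shows "norm (inv_pow n s - inv_pow n w) \<le> ln (real (Suc n)) * norm (s - w)"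
proof -
  let ?l = "ln (real (Suc n))"
  have "norm (inv_pow n s - inv_pow n w) \<le> exp 0 * norm (- s * of_real ?l - - w * of_real ?l)"
    unfolding inv_pow_def using assms by (intro norm_exp_diff_le) (auto simp del: of_nat_Suc)
  also have "- s * of_real ?l - - w * of_real ?l = (w - s) * of_real ?l"
    by (simp add: algebra_simps)
  finally show ?thesis
    by (simp add: norm_mult norm_minus_commute mult.commute del: of_nat_Suc)
qed

text \<open>
  The difference is bounded trivially by \<open>2 (n+1) powr (- Re w)\<close> and, by the mean value estimate, by
  \<open>\<bar>w\<bar> (n+1) powr (- Re w - 1)\<close>. The parameter \<open>\<theta>\<close> interpolates geometrically between the two: smaller \<open>\<theta>\<close>
  costs decay in \<open>n\<close> but gains in the dependence on \<open>Im w\<close>, which is what makes partial sums grow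
  sublinearly along vertical lines.
\<close>

lemma norm_inv_pow_step_le:
  assumes "0 \<le> Re w" "0 \<le> \<theta>" "\<theta> \<le> 1"
  shows "norm (inv_pow n w - inv_pow (Suc n) w)
    \<le> 2 * norm w powr \<theta> * real (Suc n) powr (- Re w - \<theta>)"
proof -
  let ?x = "real (Suc n)" and ?d = "norm (inv_pow n w - inv_pow (Suc n) w)"
  have mono: "?x powr (- Re w) \<ge> (?x + 1) powr (- Re w)"
    using assms by (intro powr_mono2') auto
  have trivial_bound: "?d \<le> 2 * ?x powr (- Re w)"
    using norm_triangle_ineq4 [of "inv_pow n w" "inv_pow (Suc n) w"] mono
    by (simp add: norm_inv_pow add.commute)
  have l: "ln (?x + 1) - ln ?x \<le> 1 / ?x" "ln ?x \<le> ln (?x + 1)"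
    using ln_diff_le [of "?x + 1" ?x] by auto
  have "?d \<le> exp (- Re w * ln ?x) * norm (- w * of_real (ln ?x) - - w * of_real (ln (?x + 1)))"
  proof -
    have "inv_pow (Suc n) w = exp (- w * of_real (ln (?x + 1)))"
      by (simp add: inv_pow_def add.commute)
    then show ?thesis
      using assms l(2) by (simp only: inv_pow_def) (intro norm_exp_diff_le, auto simp: mult_left_mono)
  qed
  also have "- w * of_real (ln ?x) - - w * of_real (ln (?x + 1)) = w * of_real (ln (?x + 1) - ln ?x)"
    by (simp add: algebra_simps)
  also have "exp (- Re w * ln ?x) = ?x powr (- Re w)"
    by (simp add: powr_def)
  also have "norm (w * of_real (ln (?x + 1) - ln ?x)) \<le> norm w * (1 / ?x)"
    using l by (simp only: norm_mult norm_of_real) (intro mult_left_mono, auto)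
  finally have derivative_bound: "?d \<le> ?x powr (- Re w) * (norm w / ?x)"
    by (simp add: mult_left_mono)
  have "?d = ?d powr (1 - \<theta>) * ?d powr \<theta>"
    by (cases "?d = 0") (auto simp flip: powr_add)
  also have "\<dots> \<le> (2 * ?x powr (- Re w)) powr (1 - \<theta>) * (?x powr (- Re w) * (norm w / ?x)) powr \<theta>"
    using assms trivial_bound derivative_bound by (intro mult_mono powr_mono2) auto
  also have "\<dots> = 2 powr (1 - \<theta>) * norm w powr \<theta> * ?x powr (- Re w - \<theta>)"
    by (simp add: powr_mult powr_divide powr_powr powr_diff powr_add field_simps flip: powr_add)
  also have "\<dots> \<le> 2 * norm w powr \<theta> * ?x powr (- Re w - \<theta>)"
    using powr_mono [of "1 - \<theta>" 1 2] assms by (intro mult_right_mono) auto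
  finally show ?thesis .
qed

lemma abel_dirichlet_sum:
  "dirichlet_sum b N (s + w) = dirichlet_sum b N s * inv_pow N w
     + (\<Sum>n<N. dirichlet_sum b (Suc n) s * (inv_pow n w - inv_pow (Suc n) w))"
  by (induction N) (simp_all add: dirichlet_sum_Suc inv_pow_add algebra_simps)

lemma abel_term_le:
  assumes T: "norm (dirichlet_sum b (Suc n) s) \<le> M * real (Suc (Suc n)) powr \<epsilon>" and "0 \<le> \<epsilon>" "\<epsilon> \<le> 1" "0 \<le> M"
    and w: "0 \<le> Re w" "0 \<le> \<theta>" "\<theta> \<le> 1"
  shows "norm (dirichlet_sum b (Suc n) s * (inv_pow n w - inv_pow (Suc n) w))
    \<le> 4 * M * norm w powr \<theta> * real (Suc n) powr (\<epsilon> - Re w - \<theta>)"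
proof -
  have "real (Suc (Suc n)) powr \<epsilon> \<le> (2 * real (Suc n)) powr \<epsilon>"
    using assms by (intro powr_mono2) auto
  also have "\<dots> \<le> 2 * real (Suc n) powr \<epsilon>"
    using powr_mono [of \<epsilon> 1 2] assms by (simp add: powr_mult mult_right_mono del: of_nat_Suc)
  finally have "norm (dirichlet_sum b (Suc n) s) \<le> M * (2 * real (Suc n) powr \<epsilon>)"
    using T \<open>0 \<le> M\<close> by (meson mult_left_mono order_trans)
  then have "norm (dirichlet_sum b (Suc n) s * (inv_pow n w - inv_pow (Suc n) w))
    \<le> (M * (2 * real (Suc n) powr \<epsilon>)) * (2 * norm w powr \<theta> * real (Suc n) powr (- Re w - \<theta>))"
    unfolding norm_mult using norm_inv_pow_step_le [OF w] \<open>0 \<le> M\<close> by (intro mult_mono) auto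
  also have "\<dots> = 4 * M * norm w powr \<theta> * (real (Suc n) powr \<epsilon> * real (Suc n) powr (- Re w - \<theta>))"
    by (simp add: algebra_simps)
  also have "real (Suc n) powr \<epsilon> * real (Suc n) powr (- Re w - \<theta>) = real (Suc n) powr (\<epsilon> - Re w - \<theta>)"
    by (simp add: algebra_simps flip: powr_add)
  finally show ?thesis .
qed

lemma summable_Suc_powr: "p < -1 \<Longrightarrow> summable (\<lambda>n. real (Suc n) powr p)"
  using summable_real_powr_iff [of p] by (subst summable_Suc_iff) auto

text \<open>
  Used with \<open>\<theta> = 0\<close> and \<open>Re w > 1\<close> the bound does not depend on \<open>Im w\<close>; used with \<open>\<theta>\<close> slightly above
  \<open>1 - Re w\<close> it grows like a power of \<open>\<bar>w\<bar>\<close> with exponent below 1, however small \<open>Re w > 0\<close> is.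
\<close>

lemma dirichlet_sum_bound_shift:
  assumes T: "\<And>n. norm (dirichlet_sum b n s) \<le> M" and w: "0 \<le> Re w" "0 \<le> \<theta>" "\<theta> \<le> 1" "Re w + \<theta> > 1"
  shows "norm (dirichlet_sum b N (s + w))
    \<le> M * (1 + 4 * norm w powr \<theta> * (\<Sum>n. real (Suc n) powr (- Re w - \<theta>)))"
proof -
  have M: "0 \<le> M" using order_trans [OF norm_ge_zero T] .
  let ?z = "\<lambda>n. real (Suc n) powr (- Re w - \<theta>)"
  have sm: "summable ?z"
    using w by (intro summable_Suc_powr) auto
  have "norm (\<Sum>n<N. dirichlet_sum b (Suc n) s * (inv_pow n w - inv_pow (Suc n) w))
      \<le> (\<Sum>n<N. 4 * M * norm w powr \<theta> * ?z n)"
    using abel_term_le [of b _ s M 0 w \<theta>] T M w by (intro sum_norm_le) simp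
  also have "\<dots> \<le> 4 * M * norm w powr \<theta> * (\<Sum>n. ?z n)"
    unfolding sum_distrib_left [symmetric]
    using M sm by (intro mult_left_mono sum_le_suminf) auto
  finally have 1: "norm (\<Sum>n<N. dirichlet_sum b (Suc n) s * (inv_pow n w - inv_pow (Suc n) w)) \<le> \<dots>" .
  have 2: "norm (dirichlet_sum b N s * inv_pow N w) \<le> M * 1"
    unfolding norm_mult using T M w norm_inv_pow_le_1 by (intro mult_mono) auto
  show ?thesis
    unfolding abel_dirichlet_sum [of b N s w] using norm_triangle_le [OF add_mono [OF 2 1]] 
    by (simp add: algebra_simps)
qed

text \<open>
  The rate \<open>\<rho>\<close> is chosen before the coefficients \<open>b\<close>, the point \<open>s\<close> and the bound \<open>M\<close>. This is why a bound
  on partial sums at every point of a vertical line gives uniform convergence on the line shifted by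
  \<open>\<delta>\<close>, and why, through \<open>\<rho> 0\<close>, series whose bounds \<open>M\<close> tend to 0 have sums tending to 0.
\<close>

lemma uniform_tail_bound:
  assumes "0 \<le> \<epsilon>" "\<epsilon> \<le> 1" "\<epsilon> < \<delta>"
  obtains \<rho> :: "nat \<Rightarrow> real" where "\<rho> \<longlonglongrightarrow> 0"
    "\<And>b s M. (\<And>n. norm (dirichlet_sum b n s) \<le> M * real (Suc n) powr \<epsilon>) \<Longrightarrow>
       \<exists>l. (\<lambda>N. dirichlet_sum b N (s + of_real \<delta>)) \<longlonglongrightarrow> l \<and>
           (\<forall>N. norm (dirichlet_sum b N (s + of_real \<delta>) - l) \<le> M * \<rho> N)"
proof -
  let ?w = "of_real \<delta> :: complex"
  let ?z = "\<lambda>n. 4 * \<delta> * real (Suc n) powr (\<epsilon> - \<delta> - 1)"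
  define \<rho> where "\<rho> N = real (Suc N) powr (\<epsilon> - \<delta>) + (\<Sum>n. ?z (n + N))" for N
  have sm: "summable ?z"
    using assms by (intro summable_mult summable_Suc_powr) auto
  have lim0: "(\<lambda>N. real (Suc N) powr (\<epsilon> - \<delta>)) \<longlonglongrightarrow> 0"
    using assms by (intro tendsto_neg_powr filterlim_compose [OF filterlim_real_sequentially filterlim_Suc]) auto
  have "\<rho> \<longlonglongrightarrow> 0"
    unfolding \<rho>_def [abs_def] using tendsto_add [OF lim0 suminf_exist_split2 [OF sm]] by simp
  moreover have "\<exists>l. (\<lambda>N. dirichlet_sum b N (s + ?w)) \<longlonglongrightarrow> l \<and> (\<forall>N. norm (dirichlet_sum b N (s + ?w) - l) \<le> M * \<rho> N)"
    if T: "\<And>n. norm (dirichlet_sum b n s) \<le> M * real (Suc n) powr \<epsilon>" for b s M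
  proof -
    have M: "0 \<le> M" using order_trans [OF norm_ge_zero T [of 0]] by simp
    define u where "u n = dirichlet_sum b (Suc n) s * (inv_pow n ?w - inv_pow (Suc n) ?w)" for n
    have u: "norm (u n) \<le> M * ?z n" for n
      using abel_term_le [of b n s M \<epsilon> ?w 1, OF T] M assms unfolding u_def 
      by (simp add: ac_simps)
    have smM: "summable (\<lambda>n. M * ?z n)" by (intro summable_mult sm)
    have sn: "summable (\<lambda>n. norm (u n))"
      by (rule summable_comparison_test' [OF smM, of 0]) (use u in auto)
    then have su: "summable u" by (rule summable_norm_cancel)
    have head: "norm (dirichlet_sum b N s * inv_pow N ?w) \<le> M * real (Suc N) powr (\<epsilon> - \<delta>)" for N
    proof -
      have "norm (dirichlet_sum b N s * inv_pow N ?w) \<le> (M * real (Suc N) powr \<epsilon>) * real (Suc N) powr (- \<delta>)"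
        unfolding norm_mult norm_inv_pow using T M by (intro mult_mono) auto
      also have "\<dots> = M * real (Suc N) powr (\<epsilon> - \<delta>)"
        by (simp add: powr_diff powr_minus field_simps)
      finally show ?thesis .
    qed
    have "(\<lambda>N. M * real (Suc N) powr (\<epsilon> - \<delta>)) \<longlonglongrightarrow> 0"
      using tendsto_mult_right_zero [OF lim0] .
    then have "(\<lambda>N. dirichlet_sum b N s * inv_pow N ?w) \<longlonglongrightarrow> 0"
      by (rule Lim_null_comparison [rotated]) (use head in auto)
    then have "(\<lambda>N. dirichlet_sum b N (s + ?w)) \<longlonglongrightarrow> 0 + suminf u"
      unfolding abel_dirichlet_sum [of b _ s ?w] u_def [symmetric] using summable_LIMSEQ [OF su] by (intro tendsto_add)
    moreover have "norm (dirichlet_sum b N (s + ?w) - suminf u) \<le> M * \<rho> N" for N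
    proof -
      have "dirichlet_sum b N (s + ?w) - suminf u = dirichlet_sum b N s * inv_pow N ?w - (\<Sum>n. u (n + N))"
        unfolding abel_dirichlet_sum [of b _ s ?w] u_def [symmetric] suminf_minus_initial_segment [OF su] by simp
      moreover have "norm (\<Sum>n. u (n + N)) \<le> (\<Sum>n. M * ?z (n + N))"
        using u summable_ignore_initial_segment [OF smM, of N] by (intro norm_suminf_le)
      moreover have "(\<Sum>n. M * ?z (n + N)) = M * (\<Sum>n. ?z (n + N))"
        by (intro suminf_mult summable_ignore_initial_segment [OF sm])
      ultimately show ?thesis
        using norm_triangle_ineq4 [of "dirichlet_sum b N s * inv_pow N ?w" "\<Sum>n. u (n + N)"] head [of N]
        unfolding \<rho>_def by (simp add: distrib_left)
    qed
    ultimately show ?thesis by auto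
  qed
  ultimately show thesis using that by blast
qed

section \<open>A kernel with trapezoidal Fourier transform\<close>

lemma integrable_one_plus_abs_powr:
  assumes p: "1 < p"
  shows "integrable lborel (\<lambda>t::real. (1 + \<bar>t\<bar>) powr (- p))"
proof -
  let ?f = "\<lambda>t::real. (1 + t) powr (- p)" and ?F = "\<lambda>t::real. (1 + t) powr (1 - p) / (1 - p)"
  have "(\<integral>\<^sup>+t. ennreal (?f t) * indicator {0..} t \<partial>lborel) = ennreal (0 - ?F 0)"
  proof (rule nn_integral_FTC_atLeast)
    show "DERIV ?F t :> ?f t" if "0 \<le> t" for t
    proof -
      have "DERIV (\<lambda>t. 1 + t) t :> 1"
        by (auto intro!: derivative_eq_intros)
      then have "DERIV (\<lambda>t. (1 + t) powr (1 - p)) t :> (1 - p) * (1 + t) powr (1 - p - of_nat 1) * 1"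
        by (rule DERIV_fun_powr) (use that in auto)
      from DERIV_cdivide [OF this, of "1 - p"] show ?thesis using p by simp
    qed
    have "((\<lambda>t::real. (1 + t) powr (1 - p)) \<longlongrightarrow> 0) at_top"
      using p by (intro tendsto_neg_powr filterlim_tendsto_add_at_top [OF tendsto_const filterlim_ident]) auto
    then show "(?F \<longlongrightarrow> 0) at_top"
      using tendsto_divide_zero by blast
  qed auto
  then have fin: "(\<integral>\<^sup>+t. ennreal (?f t) * indicator {0..} t \<partial>lborel) < \<infinity>"
    by simp
  have 1: "integrable lborel (\<lambda>t. indicat_real {0..} t * ?f t)"
  proof (rule integrableI_nonneg)
    have "(\<integral>\<^sup>+t. ennreal (indicat_real {0..} t * ?f t) \<partial>lborel) = (\<integral>\<^sup>+t. ennreal (?f t) * indicator {0..} t \<partial>lborel)"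
      by (intro nn_integral_cong) (auto simp: indicator_def)
    with fin show "(\<integral>\<^sup>+t. ennreal (indicat_real {0..} t * ?f t) \<partial>lborel) < \<infinity>" by simp
  qed auto
  have 2: "integrable lborel (\<lambda>t. indicat_real {0..} (- t) * ?f (- t))"
    using lborel_integrable_real_affine [OF 1, of "-1" 0] by simp
  show ?thesis
    by (rule Bochner_Integration.integrable_bound [OF Bochner_Integration.integrable_add [OF 1 2]])
      (auto simp: indicator_def abs_if)
qed

definition cos_quot :: "real \<Rightarrow> real \<Rightarrow> real" where
  "cos_quot c t = (1 - cos (c * t)) / t\<^sup>2"

lemma abs_one_minus_cos_le: "\<bar>1 - cos t\<bar> \<le> t\<^sup>2 / 2" for t :: real
proof -
  have "1 - cos t = 2 * (sin (t / 2))\<^sup>2"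
    using cos_double_sin [of "t / 2"] by simp
  moreover have "(sin (t / 2))\<^sup>2 \<le> (t / 2)\<^sup>2"
    using abs_sin_x_le_abs_x [of "t / 2"] by (simp only: abs_le_square_iff)
  ultimately show ?thesis by (simp add: power2_eq_square)
qed

definition cos_quot_const :: real where
  "cos_quot_const = (\<integral>t. cos_quot 1 t \<partial>lborel)"

lemma integrable_cos_quot_1: "integrable lborel (cos_quot 1)"
proof (rule Bochner_Integration.integrable_bound)
  show "integrable lborel (\<lambda>t::real. 5 * (1 + \<bar>t\<bar>) powr (- 2))"
    by (intro Bochner_Integration.integrable_mult_right integrable_one_plus_abs_powr) simp
  show "AE t in lborel. norm (cos_quot 1 t) \<le> norm (5 * (1 + \<bar>t\<bar>) powr (- 2))"
  proof (intro AE_I2)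
    fix t :: real
    have "0 \<le> (1 - \<bar>t\<bar>)\<^sup>2" by simp
    then have "(1 + \<bar>t\<bar>)\<^sup>2 \<le> 2 * (1 + t\<^sup>2)"
      by (simp add: power2_eq_square algebra_simps)
    then have "\<bar>1 - cos t\<bar> * (1 + \<bar>t\<bar>)\<^sup>2 \<le> \<bar>1 - cos t\<bar> * (2 * (1 + t\<^sup>2))"
      by (intro mult_left_mono) auto
    also have "\<dots> = 2 * \<bar>1 - cos t\<bar> + 2 * (\<bar>1 - cos t\<bar> * t\<^sup>2)"
      by (simp add: algebra_simps)
    also have "\<dots> \<le> 2 * (t\<^sup>2 / 2) + 2 * (2 * t\<^sup>2)"
    proof (intro add_mono mult_left_mono mult_right_mono abs_one_minus_cos_le)
      show "\<bar>1 - cos t\<bar> \<le> 2" using cos_le_one [of t] cos_ge_minus_one [of t] by linarith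
    qed auto
    finally have "\<bar>1 - cos t\<bar> * (1 + \<bar>t\<bar>)\<^sup>2 \<le> 5 * t\<^sup>2" by simp
    then have "\<bar>1 - cos t\<bar> / t\<^sup>2 \<le> 5 / (1 + \<bar>t\<bar>)\<^sup>2"
      by (cases "t = 0") (auto simp: divide_simps)
    then show "norm (cos_quot 1 t) \<le> norm (5 * (1 + \<bar>t\<bar>) powr (- 2))"
      by (simp add: cos_quot_def powr_minus divide_simps)
  qed
qed (simp add: cos_quot_def [abs_def])

text \<open>
  Scaling \<open>t\<close> by \<open>c\<close> turns the integral into its value at \<open>c = 1\<close>; the factor \<open>\<bar>c\<bar>\<close> is the source of all the
  piecewise linear Fourier transforms below.
\<close>

lemma integrable_and_integral_cos_quot:
  shows integrable_cos_quot: "integrable lborel (cos_quot c)"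
    and integral_cos_quot: "(\<integral>t. cos_quot c t \<partial>lborel) = \<bar>c\<bar> * cos_quot_const"
proof -
  have eq: "cos_quot c = (\<lambda>t. c\<^sup>2 * cos_quot 1 (0 + c * t))" if "c \<noteq> 0"
    using that by (simp add: fun_eq_iff cos_quot_def power_mult_distrib)
  have "integrable lborel (cos_quot c) \<and> (\<integral>t. cos_quot c t \<partial>lborel) = \<bar>c\<bar> * cos_quot_const"
  proof (cases "c = 0")
    case True
    then show ?thesis by (simp add: cos_quot_def [abs_def])
  next
    case False
    have int: "integrable lborel (\<lambda>t. c\<^sup>2 * cos_quot 1 (0 + c * t))"
      using lborel_integrable_real_affine [OF integrable_cos_quot_1 False]
      by (intro Bochner_Integration.integrable_mult_right)
    have "cos_quot_const = \<bar>c\<bar> * (\<integral>t. cos_quot 1 (0 + c * t) \<partial>lborel)"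
      using lborel_integral_real_affine [OF False, of "cos_quot 1" 0] by (simp add: cos_quot_const_def)
    moreover have "c\<^sup>2 = \<bar>c\<bar> * \<bar>c\<bar>" by (simp add: power2_eq_square)
    ultimately have "(\<integral>t. c\<^sup>2 * cos_quot 1 (0 + c * t) \<partial>lborel) = \<bar>c\<bar> * cos_quot_const"
      by (simp only: Bochner_Integration.integral_mult_right_zero mult.assoc)
    with int show ?thesis
      unfolding eq [OF False, symmetric] by blast
  qed
  then show "integrable lborel (cos_quot c)" "(\<integral>t. cos_quot c t \<partial>lborel) = \<bar>c\<bar> * cos_quot_const" by auto
qed

text \<open>
  The value of the constant is \<open>\<pi>\<close>, but only its positivity matters, since it cancels.
\<close>

lemma cos_quot_const_pos: "0 < cos_quot_const"
proof -
  have nonneg: "0 \<le> cos_quot 1 t" for t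
    by (simp add: cos_quot_def)
  have "cos_quot_const \<noteq> 0"
  proof
    assume "cos_quot_const = 0"
    then have "AE t in lborel. cos_quot 1 t = 0"
      using integral_nonneg_eq_0_iff_AE [OF integrable_cos_quot_1] nonneg by (simp add: cos_quot_const_def)
    then have "AE t in lborel. t \<notin> {1<..<2::real}"
    proof eventually_elim
      case (elim t)
      then show ?case
        using cos_monotone_0_pi [of 0 t] pi_gt3 by (auto simp: cos_quot_def)
    qed
    then have "emeasure lborel {1<..<2::real} = 0"
      by (subst (asm) AE_iff_measurable [OF _ refl]) (auto simp: greaterThanLessThan_def greaterThan_def lessThan_def Int_def)
    then show False by simp
  qed
  moreover have "0 \<le> cos_quot_const"
    unfolding cos_quot_const_def using nonneg by (intro Bochner_Integration.integral_nonneg) auto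
  ultimately show ?thesis by simp
qed

definition trapezoid_kernel :: "real \<Rightarrow> real \<Rightarrow> real \<Rightarrow> real" where
  "trapezoid_kernel A B t = (cos (A * t) - cos (B * t)) / t\<^sup>2"

lemma trapezoid_kernel_eq: "trapezoid_kernel A B t = cos_quot B t - cos_quot A t"
  by (simp add: trapezoid_kernel_def cos_quot_def diff_divide_distrib)

lemma integrable_trapezoid_kernel: "integrable lborel (trapezoid_kernel A B)"
  unfolding trapezoid_kernel_eq [abs_def] by (intro Bochner_Integration.integrable_diff integrable_cos_quot)

lemma borel_measurable_trapezoid_kernel [measurable]: "trapezoid_kernel A B \<in> borel_measurable borel"
  unfolding trapezoid_kernel_def [abs_def] by measurable

text \<open>
  Products of cosines become sums of \<^const>\<open>cos_quot\<close>, so the transform at \<open>l\<close> is a multiple of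
  \<open>\<bar>B - l\<bar> + \<bar>B + l\<bar> - \<bar>A - l\<bar> - \<bar>A + l\<bar>\<close>. As a function of \<open>l\<close> this is a trapezoid, constant on \<open>[0, A]\<close> and
  zero beyond \<open>B\<close>. The sine part vanishes because the kernel is even.
\<close>

lemma fourier_trapezoid_kernel:
  assumes "0 \<le> A" "A < B" "0 \<le> l" "l \<le> A \<or> B \<le> l"
  shows "(\<integral>t. of_real (trapezoid_kernel A B t) * cis (- (l * t)) \<partial>lborel)
     = (if l \<le> A then of_real (cos_quot_const * (B - A)) else 0)"
proof -
  let ?k = "trapezoid_kernel A B"
  let ?c = "\<lambda>t. ?k t * cos (l * t)" and ?s = "\<lambda>t. ?k t * sin (l * t)"
  have c_eq: "?c = (\<lambda>t. (1/2) * (cos_quot (B - l) t + cos_quot (B + l) t - cos_quot (A - l) t - cos_quot (A + l) t))"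
    by (rule ext) (simp add: trapezoid_kernel_def cos_quot_def left_diff_distrib distrib_right cos_add cos_diff
        diff_divide_distrib add_divide_distrib)
  have int: "integrable lborel ?c" "integrable lborel ?s"
    by (rule Bochner_Integration.integrable_bound [OF integrable_trapezoid_kernel [of A B]];
        auto simp: abs_mult mult_left_le)+
  have "(\<integral>t. ?c t \<partial>lborel) = (1/2) * (\<bar>B - l\<bar> + \<bar>B + l\<bar> - \<bar>A - l\<bar> - \<bar>A + l\<bar>) * cos_quot_const"
    unfolding c_eq by (simp add: integrable_cos_quot integral_cos_quot algebra_simps)
  also have "\<dots> = (if l \<le> A then cos_quot_const * (B - A) else 0)"
    using assms by (auto simp: abs_if)
  finally have c: "(\<integral>t. ?c t \<partial>lborel) = (if l \<le> A then cos_quot_const * (B - A) else 0)" .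
  have "(\<integral>t. ?s t \<partial>lborel) = (\<integral>t. ?s (0 + (- 1) * t) \<partial>lborel)"
    using lborel_integral_real_affine [of "-1" ?s 0] by simp
  also have "\<dots> = - (\<integral>t. ?s t \<partial>lborel)"
    by (simp add: trapezoid_kernel_def)
  finally have s: "(\<integral>t. ?s t \<partial>lborel) = 0" by simp
  have "(\<integral>t. of_real (?k t) * cis (- (l * t)) \<partial>lborel)
      = (\<integral>t. complex_of_real (?c t) - \<i> * complex_of_real (?s t) \<partial>lborel)"
    by (intro Bochner_Integration.integral_cong) (auto simp: complex_eq_iff)
  also have "\<dots> = of_real (\<integral>t. ?c t \<partial>lborel) - \<i> * of_real (\<integral>t. ?s t \<partial>lborel)"
  proof -
    have "integrable lborel (\<lambda>t. complex_of_real (?c t))" "integrable lborel (\<lambda>t. \<i> * complex_of_real (?s t))"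
      using int by (auto intro: Bochner_Integration.integrable_mult_right simp del: of_real_mult)
    then show ?thesis
      by (simp only: Bochner_Integration.integral_diff Bochner_Integration.integral_mult_right_zero
          integral_complex_of_real)
  qed
  finally show ?thesis
    unfolding c s by simp
qed

section \<open>Bohr's estimate for partial sums\<close>

lemma abs_cos_diff_le: "\<bar>cos x - cos y\<bar> \<le> \<bar>x - y\<bar>" for x y :: real
proof -
  have "norm (cos x - cos y) \<le> 1 * norm (x - y)"
  proof (rule field_differentiable_bound)
    show "(cos has_field_derivative - sin z) (at z within UNIV)" for z :: real
      by (rule DERIV_subset [OF DERIV_cos]) simp
  qed auto
  then show ?thesis by simp
qed

text \<open>
  With \<open>A = ln N\<close>, \<open>B = ln (N + 1)\<close> and \<open>D = B - A\<close>, the difference of cosines is at most \<open>B D t\<^sup>2\<close>,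
  \<open>D \<bar>t\<bar>\<close> and 2. The first estimate handles \<open>\<bar>t\<bar> \<le> 1\<close>, where \<open>B\<close> is logarithmic in \<open>N\<close>. For \<open>\<bar>t\<bar> > 1\<close>
  a geometric mean of the other two makes the kernel integrable at the price of \<open>D powr (- \<epsilon>)\<close>, which
  is of order \<open>N powr \<epsilon>\<close>. Sharper estimates give a logarithm; any power is enough here.
\<close>

lemma trapezoid_kernel_bound:
  assumes \<epsilon>: "0 < \<epsilon>" "\<epsilon> \<le> 1" and N: "1 \<le> N"
  shows "\<bar>trapezoid_kernel (ln (real N)) (ln (real (Suc N))) t\<bar>
    \<le> (ln (real (Suc N)) - ln (real N)) *
        ((4 / \<epsilon> + 8) * real (Suc N) powr \<epsilon> * (1 + \<bar>t\<bar>) powr (- (1 + \<epsilon>)))"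
proof -
  define A B where "A = ln (real N)" and "B = ln (real (Suc N))"
  define D where "D = B - A"
  define x where "x = \<bar>cos (A * t) - cos (B * t)\<bar>"
  let ?n = "real (Suc N)"
  have D: "1 / ?n \<le> D"
  proof -
    have "- D = ln (real N) - ln ?n" by (simp add: D_def A_def B_def)
    also have "\<dots> \<le> (real N - ?n) / ?n"
      using N by (intro ln_diff_le) auto
    finally show ?thesis by simp
  qed
  then have D0: "0 < D"
    by (rule less_le_trans [rotated]) simp
  have A0: "0 \<le> A" using N by (simp add: A_def)
  have B_bound: "B \<le> ?n powr \<epsilon> / \<epsilon>"
    unfolding B_def using \<epsilon> by (intro ln_powr_bound) auto
  have x2: "x \<le> 2"
    unfolding x_def using cos_le_one cos_ge_minus_one by (smt (verit))
  have xD: "x \<le> D * \<bar>t\<bar>"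
  proof -
    have "x \<le> \<bar>A * t - B * t\<bar>" unfolding x_def by (rule abs_cos_diff_le)
    also have "A * t - B * t = - (D * t)" by (simp add: D_def algebra_simps)
    finally show ?thesis using D0 by (simp add: abs_mult)
  qed
  have xBD: "x \<le> B * D * t\<^sup>2"
  proof -
    have "x = 2 * \<bar>sin ((A * t + B * t) / 2)\<bar> * \<bar>sin ((B * t - A * t) / 2)\<bar>"
      unfolding x_def cos_diff_cos by (simp add: abs_mult)
    also have "\<dots> \<le> 2 * \<bar>(A * t + B * t) / 2\<bar> * \<bar>(B * t - A * t) / 2\<bar>"
      by (intro mult_mono abs_sin_x_le_abs_x) auto
    also have "\<dots> = 2 * ((A + B) / 2 * \<bar>t\<bar>) * (D / 2 * \<bar>t\<bar>)"
    proof -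
      have "(A * t + B * t) / 2 = (A + B) / 2 * t" "(B * t - A * t) / 2 = D / 2 * t"
        by (simp_all add: D_def algebra_simps diff_divide_distrib)
      moreover have "0 \<le> (A + B) / 2" using A0 D0 by (simp add: D_def)
      ultimately show ?thesis using D0 by (simp only: abs_mult)
    qed
    also have "\<dots> = (A + B) / 2 * D * t\<^sup>2"
      by (simp add: power2_eq_square)
    also have "\<dots> \<le> B * D * t\<^sup>2"
      using D0 A0 by (intro mult_right_mono) (auto simp: D_def)
    finally show ?thesis .
  qed
  have k: "\<bar>trapezoid_kernel A B t\<bar> = x / t\<^sup>2"
    by (simp add: trapezoid_kernel_def x_def)
  have "x / t\<^sup>2 \<le> D * ((4 / \<epsilon> + 8) * ?n powr \<epsilon> * (1 + \<bar>t\<bar>) powr (- (1 + \<epsilon>)))"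
  proof (cases "\<bar>t\<bar> \<le> 1")
    case True
    have "(1 + \<bar>t\<bar>) powr (1 + \<epsilon>) \<le> 2 powr (1 + \<epsilon>)"
      using True \<epsilon> by (intro powr_mono2) auto
    also have "\<dots> \<le> 2 powr 2" using \<epsilon> by (intro powr_mono) auto
    finally have le4: "1 \<le> 4 * (1 + \<bar>t\<bar>) powr (- (1 + \<epsilon>))"
      by (simp only: powr_minus) (simp add: divide_simps)
    have "x / t\<^sup>2 \<le> B * D"
      using xBD D0 A0 by (cases "t = 0") (auto simp: divide_simps D_def)
    also have "\<dots> \<le> (?n powr \<epsilon> / \<epsilon>) * D"
      using B_bound D0 by (intro mult_right_mono) auto
    also have "\<dots> \<le> (?n powr \<epsilon> / \<epsilon>) * D * (4 * (1 + \<bar>t\<bar>) powr (- (1 + \<epsilon>)))"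
      using mult_left_mono [OF le4, of "(?n powr \<epsilon> / \<epsilon>) * D"] D0 \<epsilon> by simp
    also have "\<dots> = D * (4 / \<epsilon> * ?n powr \<epsilon> * (1 + \<bar>t\<bar>) powr (- (1 + \<epsilon>)))"
      by simp
    also have "\<dots> \<le> D * ((4 / \<epsilon> + 8) * ?n powr \<epsilon> * (1 + \<bar>t\<bar>) powr (- (1 + \<epsilon>)))"
      using D0 by (intro mult_left_mono mult_right_mono) auto
    finally show ?thesis .
  next
    case False
    have "x = x powr (1 - \<epsilon>) * x powr \<epsilon>"
      by (cases "x = 0") (auto simp: x_def simp flip: powr_add)
    also have "\<dots> \<le> (D * \<bar>t\<bar>) powr (1 - \<epsilon>) * 2 powr \<epsilon>"
      using xD x2 \<epsilon> by (intro mult_mono powr_mono2) (auto simp: x_def)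
    finally have "x / t\<^sup>2 \<le> (D * \<bar>t\<bar>) powr (1 - \<epsilon>) * 2 powr \<epsilon> / t\<^sup>2"
      by (intro divide_right_mono) auto
    also have "\<dots> = D * ((2 / D) powr \<epsilon> * \<bar>t\<bar> powr (- (1 + \<epsilon>)))"
    proof -
      have t2: "t\<^sup>2 = \<bar>t\<bar> powr 2" using False by simp
      show ?thesis unfolding t2 using D0 False
        by (simp add: powr_mult powr_divide powr_diff powr_add powr_minus field_simps power2_eq_square)
    qed
    also have "\<dots> \<le> D * ((2 * ?n) powr \<epsilon> * (((1 + \<bar>t\<bar>) / 2) powr (- (1 + \<epsilon>))))"
    proof (intro mult_left_mono mult_mono)
      show "(2 / D) powr \<epsilon> \<le> (2 * ?n) powr \<epsilon>"
      proof (rule powr_mono2)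
        have "1 / D \<le> ?n" using D D0 by (simp add: divide_simps mult.commute)
        then have "2 * (1 / D) \<le> 2 * ?n" by (rule mult_left_mono) simp
        then show "2 / D \<le> 2 * ?n" by simp
      qed (use D0 \<epsilon> in auto)
      show "\<bar>t\<bar> powr (- (1 + \<epsilon>)) \<le> ((1 + \<bar>t\<bar>) / 2) powr (- (1 + \<epsilon>))"
        using False \<epsilon> by (intro powr_mono2') auto
    qed (use D0 in auto)
    also have "\<dots> = D * ((2 powr \<epsilon> * 2 powr (1 + \<epsilon>)) * ?n powr \<epsilon> * (1 + \<bar>t\<bar>) powr (- (1 + \<epsilon>)))"
    proof -
      have "(2 * ?n) powr \<epsilon> = 2 powr \<epsilon> * ?n powr \<epsilon>" by (rule powr_mult)
      moreover have "((1 + \<bar>t\<bar>) / 2) powr (- (1 + \<epsilon>)) = 2 powr (1 + \<epsilon>) * (1 + \<bar>t\<bar>) powr (- (1 + \<epsilon>))"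
        by (simp only: powr_divide powr_minus [of 2]) (simp add: field_simps)
      ultimately show ?thesis by simp
    qed
    also have "\<dots> \<le> D * ((4 / \<epsilon> + 8) * ?n powr \<epsilon> * (1 + \<bar>t\<bar>) powr (- (1 + \<epsilon>)))"
    proof -
      have "2 powr \<epsilon> * 2 powr (1 + \<epsilon>) = 2 powr (1 + 2 * \<epsilon>)" by (simp add: add.commute flip: powr_add)
      also have "\<dots> \<le> 2 powr (3::real)" using \<epsilon> by (intro powr_mono) auto
      also have "\<dots> \<le> 4 / \<epsilon> + 8" using \<epsilon> by simp
      finally show ?thesis using D0 by (intro mult_left_mono mult_right_mono) auto
    qed
    finally show ?thesis .
  qed
  then show ?thesis
    unfolding k [symmetric] A_def [symmetric] B_def [symmetric] D_def by simp
qed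

definition bohr_const :: "real \<Rightarrow> real" where
  "bohr_const \<epsilon> = (4 / \<epsilon> + 8) * (\<integral>t. (1 + \<bar>t\<bar>) powr (- (1 + \<epsilon>)) \<partial>lborel) / cos_quot_const"

lemma bohr_const_nonneg: "0 < \<epsilon> \<Longrightarrow> 0 \<le> bohr_const \<epsilon>"
  unfolding bohr_const_def using cos_quot_const_pos
  by (intro divide_nonneg_nonneg mult_nonneg_nonneg Bochner_Integration.integral_nonneg) auto

lemma inv_pow_imaginary: "inv_pow n (\<i> * of_real t) = cis (- (ln (real (Suc n)) * t))"
  by (simp add: inv_pow_def cis_conv_exp algebra_simps del: of_nat_Suc)

text \<open>
  No frequency \<open>ln (n + 1)\<close> lies strictly between \<open>ln N\<close> and \<open>ln (N + 1)\<close>, so the trapezoid acts on a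
  Dirichlet sum as the sharp cut-off after \<open>N\<close> terms.
\<close>

lemma integral_kernel_dirichlet_sum:
  assumes "1 \<le> N" "N \<le> L"
  defines "A \<equiv> ln (real N)" and "B \<equiv> ln (real (Suc N))"
  shows "(\<integral>t. of_real (trapezoid_kernel A B t) * dirichlet_sum b L (s + \<i> * of_real t) \<partial>lborel)
    = of_real (cos_quot_const * (B - A)) * dirichlet_sum b N s"
proof -
  let ?k = "\<lambda>t. complex_of_real (trapezoid_kernel A B t)"
  let ?l = "\<lambda>n. ln (real (Suc n))"
  have int: "integrable lborel (\<lambda>t. ?k t * cis (- (?l n * t)))" for n
  proof (rule Bochner_Integration.integrable_bound [OF integrable_trapezoid_kernel [of A B]])
    have [measurable]: "(\<lambda>t. cis (- (?l n * t))) \<in> borel_measurable borel"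
      by (intro borel_measurable_continuous_onI continuous_intros)
    show "(\<lambda>t. ?k t * cis (- (?l n * t))) \<in> borel_measurable lborel" by measurable
  qed (auto simp: norm_mult)
  have "(\<integral>t. ?k t * dirichlet_sum b L (s + \<i> * of_real t) \<partial>lborel)
     = (\<integral>t. (\<Sum>n<L. (b n * inv_pow n s) * (?k t * cis (- (?l n * t)))) \<partial>lborel)"
    by (simp only: dirichlet_sum_add_arg inv_pow_imaginary sum_distrib_left mult.left_commute mult.assoc)
  also have "\<dots> = (\<Sum>n<L. (b n * inv_pow n s) * (\<integral>t. ?k t * cis (- (?l n * t)) \<partial>lborel))"
    using int by (subst Bochner_Integration.integral_sum) auto
  also have "\<dots> = (\<Sum>n<L. (b n * inv_pow n s) * (if n < N then of_real (cos_quot_const * (B - A)) else 0))"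
  proof (intro sum.cong refl arg_cong2 [where f = "(*)"])
    fix n
    have "(\<integral>t. ?k t * cis (- (?l n * t)) \<partial>lborel) = (if ?l n \<le> A then of_real (cos_quot_const * (B - A)) else 0)"
      using assms by (intro fourier_trapezoid_kernel) (auto simp: A_def B_def)
    moreover have "?l n \<le> A \<longleftrightarrow> n < N"
      using assms by (auto simp: A_def)
    ultimately show "(\<integral>t. ?k t * cis (- (?l n * t)) \<partial>lborel) = (if n < N then of_real (cos_quot_const * (B - A)) else 0)"
      by simp
  qed
  also have "\<dots> = (\<Sum>n<N. (b n * inv_pow n s) * of_real (cos_quot_const * (B - A)))"
    using assms by (intro sum.mono_neutral_cong_right) auto
  finally show ?thesis
    unfolding dirichlet_sum_def sum_distrib_left by (simp add: mult.commute)
qed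

text \<open>
  Bohr's estimate: the partial sums are controlled by the supremum of the sum function alone, up to an
  arbitrarily small power of \<open>N\<close>. The kernel identity for long partial sums passes to the limit \<open>F\<close> by
  dominated convergence. The growth assumption serves only to supply the dominating function: its
  constant \<open>C\<close> does not enter the result, and an exponent \<open>\<theta> < 1\<close> is what decay of the kernel like
  \<open>\<bar>t\<bar> powr (- 2)\<close> can absorb.
\<close>

lemma bohr_partial_sum_bound:
  assumes lim: "\<And>t. (\<lambda>N. dirichlet_sum b N (s + \<i> * of_real t)) \<longlonglongrightarrow> F t"
    and bound: "\<And>t. norm (F t) \<le> M"
    and growth: "\<And>N t. norm (dirichlet_sum b N (s + \<i> * of_real t)) \<le> C * (1 + \<bar>t\<bar>) powr \<theta>"
    and \<theta>: "\<theta> < 1" and \<epsilon>: "0 < \<epsilon>" "\<epsilon> \<le> 1"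
  shows "norm (dirichlet_sum b N s) \<le> M * bohr_const \<epsilon> * real (Suc N) powr \<epsilon>"
proof (cases "N = 0")
  case True
  then show ?thesis
    using bohr_const_nonneg [OF \<epsilon>(1)] order_trans [OF norm_ge_zero bound] by simp
next
  case False
  then have N: "1 \<le> N" by simp
  define A B where "A = ln (real N)" and "B = ln (real (Suc N))"
  let ?k = "trapezoid_kernel A B"
  let ?S = "\<lambda>L t. dirichlet_sum b L (s + \<i> * of_real t)"
  have AB: "0 \<le> A" "A < B" using N by (auto simp: A_def B_def)
  \<comment> \<open>For dominated convergence the fixed choice \<open>\<epsilon> = 1\<close> is best: it gives the full quadratic decay.\<close>
  define E where "E = (B - A) * ((4 + 8) * real (Suc N) powr 1)"
  have M: "0 \<le> M" using order_trans [OF norm_ge_zero bound] .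
  have C: "0 \<le> C" using order_trans [OF norm_ge_zero growth [of 0 0]] by simp
  have meas [measurable]: "?S L \<in> borel_measurable borel" for L
    unfolding dirichlet_sum_def inv_pow_def by measurable
  have Fmeas [measurable]: "F \<in> borel_measurable borel"
    by (rule borel_measurable_LIMSEQ_metric [OF meas lim])
  have int_w: "integrable lborel (\<lambda>t. E * C * (1 + \<bar>t\<bar>) powr (- (2 - \<theta>)))"
    using \<theta> by (intro Bochner_Integration.integrable_mult_right integrable_one_plus_abs_powr) auto
  have dom: "norm (of_real (?k t) * ?S L t) \<le> E * C * (1 + \<bar>t\<bar>) powr (- (2 - \<theta>))" for L t
  proof -
    have "norm (of_real (?k t) * ?S L t) \<le> (E * (1 + \<bar>t\<bar>) powr (- 2)) * (C * (1 + \<bar>t\<bar>) powr \<theta>)"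
      unfolding norm_mult norm_of_real
      using trapezoid_kernel_bound [of 1 N t] N growth AB
      by (intro mult_mono) (auto simp: A_def B_def E_def mult.assoc simp del: of_nat_Suc)
    also have "\<dots> = E * C * ((1 + \<bar>t\<bar>) powr (- 2) * (1 + \<bar>t\<bar>) powr \<theta>)"
      by simp
    also have "(1 + \<bar>t\<bar>) powr (- 2) * (1 + \<bar>t\<bar>) powr \<theta> = (1 + \<bar>t\<bar>) powr (- (2 - \<theta>))"
      by (simp flip: powr_add)
    finally show ?thesis .
  qed
  have "(\<lambda>L. \<integral>t. of_real (?k t) * ?S L t \<partial>lborel) \<longlonglongrightarrow> (\<integral>t. of_real (?k t) * F t \<partial>lborel)"
    by (rule integral_dominated_convergence [OF _ _ int_w]) (use dom lim in \<open>auto intro!: AE_I2 tendsto_intros simp del: minus_diff_eq\<close>)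
  moreover have "(\<lambda>L. \<integral>t. of_real (?k t) * ?S L t \<partial>lborel)
      \<longlonglongrightarrow> of_real (cos_quot_const * (B - A)) * dirichlet_sum b N s"
    by (rule tendsto_eventually, rule eventually_sequentiallyI [of N])
      (use integral_kernel_dirichlet_sum [OF N] in \<open>simp add: A_def B_def\<close>)
  ultimately have eq: "of_real (cos_quot_const * (B - A)) * dirichlet_sum b N s = (\<integral>t. of_real (?k t) * F t \<partial>lborel)"
    by (rule LIMSEQ_unique [rotated])
  let ?K = "(4 / \<epsilon> + 8) * real (Suc N) powr \<epsilon>"
  have int_v: "integrable lborel (\<lambda>t. M * (B - A) * ?K * (1 + \<bar>t\<bar>) powr (- (1 + \<epsilon>)))"
    using \<epsilon> by (intro Bochner_Integration.integrable_mult_right integrable_one_plus_abs_powr) auto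
  have dom_F: "norm (of_real (?k t) * F t) \<le> M * (B - A) * ?K * (1 + \<bar>t\<bar>) powr (- (1 + \<epsilon>))" for t
  proof -
    have "norm (of_real (?k t) * F t) \<le> ((B - A) * (?K * (1 + \<bar>t\<bar>) powr (- (1 + \<epsilon>)))) * M"
      unfolding norm_mult norm_of_real
      using trapezoid_kernel_bound [OF \<epsilon> N, of t] bound AB \<epsilon>
      by (intro mult_mono) (auto simp: A_def B_def simp del: of_nat_Suc)
    then show ?thesis by (simp add: mult_ac)
  qed
  have int_F: "integrable lborel (\<lambda>t. of_real (?k t) * F t)"
    by (rule Bochner_Integration.integrable_bound [OF int_v]) (use dom_F in \<open>auto intro!: AE_I2 intro: order_trans [OF _ abs_ge_self]\<close>)
  have "cos_quot_const * (B - A) * norm (dirichlet_sum b N s) = norm (\<integral>t. of_real (?k t) * F t \<partial>lborel)"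
    unfolding eq [symmetric] norm_mult norm_of_real using cos_quot_const_pos AB by simp
  also have "\<dots> \<le> (\<integral>t. M * (B - A) * ?K * (1 + \<bar>t\<bar>) powr (- (1 + \<epsilon>)) \<partial>lborel)"
    by (rule Bochner_Integration.integral_norm_bound_integral [OF int_F int_v dom_F])
  also have "\<dots> = M * (B - A) * ?K * (\<integral>t. (1 + \<bar>t\<bar>) powr (- (1 + \<epsilon>)) \<partial>lborel)"
    by (rule Bochner_Integration.integral_mult_right_zero)
  also have "\<dots> = cos_quot_const * (B - A) * (M * bohr_const \<epsilon> * real (Suc N) powr \<epsilon>)"
    unfolding bohr_const_def using cos_quot_const_pos by simp
  finally show ?thesis
    using cos_quot_const_pos AB by (simp add: mult_le_cancel_left_pos)
qed

section \<open>The maximum principle on the half-plane\<close>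

text \<open>
  A Phragmen-Lindelof argument: the sum is bounded on the half-plane, so dividing by \<open>1 + \<epsilon> z\<close> makes it
  tend to 0 at infinity without increasing it on the boundary. The maximum modulus principle on a
  large half-disc then applies, and \<open>\<epsilon>\<close> tends to 0 at the end.
\<close>

lemma dirichlet_sum_maximum_principle:
  assumes bound: "\<And>t. norm (dirichlet_sum b N (\<i> * of_real t)) \<le> M" and s: "0 \<le> Re s"
  shows "norm (dirichlet_sum b N s) \<le> M"
proof -
  define K where "K = (\<Sum>n<N. norm (b n))"
  have M: "0 \<le> M" using order_trans [OF norm_ge_zero bound] .
  have "norm (dirichlet_sum b N s) \<le> M * (1 + \<epsilon> * norm s)" if \<epsilon>: "0 < \<epsilon>" for \<epsilon>
  proof -
    define f where "f z = dirichlet_sum b N z / (1 + of_real \<epsilon> * z)" for z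
    have denom: "1 \<le> norm (1 + of_real \<epsilon> * z)" "\<epsilon> * norm z \<le> norm (1 + of_real \<epsilon> * z)" if "0 \<le> Re z" for z
    proof -
      have "1 \<le> Re (1 + of_real \<epsilon> * z)" using that \<epsilon> by simp
      then show "1 \<le> norm (1 + of_real \<epsilon> * z)" using complex_Re_le_cmod order_trans by blast
      have "norm (of_real \<epsilon> * z) \<le> norm (1 + of_real \<epsilon> * z)"
        using that \<epsilon> by (simp add: cmod_def)
      then show "\<epsilon> * norm z \<le> norm (1 + of_real \<epsilon> * z)"
        using \<epsilon> by (simp add: norm_mult)
    qed
    have K: "0 \<le> K" by (simp add: K_def sum_nonneg)
    have bd: "norm (f s) \<le> max M \<eta>" if \<eta>: "0 < \<eta>" for \<eta>
    proof -
      \<comment> \<open>At radius \<open>R\<close> the quotient is at most \<open>\<eta>\<close>.\<close>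
      define R where "R = max (norm s) (max 1 (K / (\<epsilon> * \<eta>)))"
      define S where "S = {z. 0 \<le> Re z} \<inter> cball 0 R"
      have R: "norm s \<le> R" "0 < R" "K / (\<epsilon> * \<eta>) \<le> R" by (auto simp: R_def)
      have "closed S" unfolding S_def by (intro closed_Int closed_halfspace_Re_ge closed_cball)
      have hol: "f holomorphic_on {z. 0 \<le> Re z}"
        unfolding f_def [abs_def] using denom(1) by (intro holomorphic_intros holomorphic_dirichlet_sum) force
      show ?thesis
      proof (rule maximum_modulus_frontier [where S = S and f = f])
        show "f holomorphic_on interior S"
          by (rule holomorphic_on_subset [OF hol], rule order_trans [OF interior_subset]) (auto simp: S_def)
        show "continuous_on (closure S) f"
          using \<open>closed S\<close> holomorphic_on_imp_continuous_on [OF holomorphic_on_subset [OF hol, of S]]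
          by (auto simp: S_def)
        show "bounded S" by (simp add: S_def bounded_Int)
        show "s \<in> S" using s R by (simp add: S_def)
        fix z assume z: "z \<in> frontier S"
        have "z \<in> S" using z \<open>closed S\<close> by (simp add: frontier_def)
        have "{z. 0 < Re z} \<inter> ball 0 R \<subseteq> interior S"
          by (rule interior_maximal) (auto simp: S_def open_halfspace_Re_gt intro!: open_Int)
        then consider "Re z = 0" | "norm z = R" "0 \<le> Re z"
          using z \<open>z \<in> S\<close> by (force simp: frontier_def S_def)
        then show "norm (f z) \<le> max M \<eta>"
        proof cases
          case 1
          then have "z = \<i> * of_real (Im z)" by (simp add: complex_eq_iff)
          then have "norm (dirichlet_sum b N z) \<le> M" using bound by metis
          then have "norm (f z) \<le> M / 1"
            unfolding f_def norm_divide using denom(1) [of z] 1 M by (intro frac_le) auto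
          then show ?thesis by simp
        next
          case 2
          then have "norm (f z) \<le> K / (\<epsilon> * R)"
            unfolding f_def norm_divide using denom(2) [of z] \<epsilon> R(2) K norm_dirichlet_sum_le [of z b N]
            by (intro frac_le) (auto simp: K_def)
          also have "\<dots> \<le> \<eta>"
            using R \<epsilon> \<eta> by (simp add: field_simps)
          finally show ?thesis by simp
        qed
      qed
    qed
    have "norm (f s) \<le> M"
    proof (rule ccontr)
      assume "\<not> norm (f s) \<le> M"
      then show False using bd [of "(norm (f s) + M) / 2"] M by (auto simp: max_def split: if_splits)
    qed
    then have "norm (dirichlet_sum b N s) \<le> M * norm (1 + of_real \<epsilon> * s)"
      using denom(1) [OF s] by (simp add: f_def norm_divide divide_simps split: if_splits)
    also have "\<dots> \<le> M * (1 + \<epsilon> * norm s)"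
      using M \<epsilon> norm_triangle_ineq [of 1 "of_real \<epsilon> * s"]
      by (intro mult_left_mono) (auto simp: norm_mult)
    finally show ?thesis .
  qed
  then have "\<forall>\<^sub>F \<epsilon> in at_right 0. norm (dirichlet_sum b N s) \<le> M * (1 + \<epsilon> * norm s)"
    by (auto simp: eventually_at_right_less intro: eventually_mono [OF eventually_at_right_less])
  moreover have "((\<lambda>\<epsilon>. M * (1 + \<epsilon> * norm s)) \<longlongrightarrow> M * (1 + 0 * norm s)) (at_right 0)"
    by (intro tendsto_intros)
  ultimately show ?thesis
    using tendsto_lowerbound by force
qed

section \<open>From uniform limits to boundary values\<close>

lemma dirichlet_polynomial_iff:
  "dirichlet_polynomial P \<longleftrightarrow> (\<exists>b N. P = dirichlet_sum b N)"
proof -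
  have eq: "(\<Sum>n=1..N. a n * (1 / of_nat n powr s)) = dirichlet_sum (\<lambda>n. a (Suc n)) N s" for N a s
    unfolding dirichlet_sum_def inv_pow_eq_powr
    by (rule sum.reindex_bij_witness [of _ Suc "\<lambda>n. n - 1"]) auto
  show ?thesis
  proof
    assume "dirichlet_polynomial P"
    then show "\<exists>b N. P = dirichlet_sum b N"
      unfolding dirichlet_polynomial_def eq by blast
  next
    assume "\<exists>b N. P = dirichlet_sum b N"
    then obtain b N where "P = dirichlet_sum (\<lambda>n. b (Suc n - 1)) N" by auto
    then show "dirichlet_polynomial P"
      unfolding dirichlet_polynomial_def by (intro exI [of _ N] exI [of _ "\<lambda>n. b (n - 1)"]) (simp only: eq)
  qed
qed

lemma A_right_half_plane_iff:
  "f \<in> A_right_half_plane \<longleftrightarrow>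
    (\<exists>b. \<forall>s. 0 < Re s \<longrightarrow> (\<lambda>N. dirichlet_sum b N s) \<longlonglongrightarrow> f s) \<and> uniformly_continuous_on {s. 0 < Re s} f"
proof -
  have eq: "(\<lambda>n. a (Suc n) / of_nat (Suc n) powr s) sums v \<longleftrightarrow> (\<lambda>N. dirichlet_sum (\<lambda>n. a (Suc n)) N s) \<longlonglongrightarrow> v"
    for a s and v :: complex
    by (simp add: sums_def dirichlet_sum_def inv_pow_eq_powr)
  have "(\<exists>a. \<forall>s. 0 < Re s \<longrightarrow> (\<lambda>N. dirichlet_sum (\<lambda>n. a (Suc n)) N s) \<longlonglongrightarrow> f s)
    \<longleftrightarrow> (\<exists>b. \<forall>s. 0 < Re s \<longrightarrow> (\<lambda>N. dirichlet_sum b N s) \<longlonglongrightarrow> f s)" (is "?L \<longleftrightarrow> ?R")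
  proof
    assume ?R
    then obtain b where "\<forall>s. 0 < Re s \<longrightarrow> (\<lambda>N. dirichlet_sum (\<lambda>n. b (Suc n - 1)) N s) \<longlonglongrightarrow> f s" by auto
    then show ?L by (rule exI [of _ "\<lambda>n. b (n - 1)"])
  qed blast
  then show ?thesis
    unfolding A_right_half_plane_def right_half_plane_def mem_Collect_eq Ball_def eq by simp
qed

lemma uniformly_continuous_dirichlet_sum:
  "uniformly_continuous_on {s. 0 \<le> Re s} (dirichlet_sum b N)"
proof -
  have "uniformly_continuous_on {s. 0 \<le> Re s} (inv_pow n)" for n
  proof (rule lipschitz_on_uniformly_continuous)
    show "lipschitz_on (ln (real (Suc n))) {s. 0 \<le> Re s} (inv_pow n)"
      using norm_inv_pow_diff_arg_le by (intro lipschitz_onI) (auto simp: dist_norm simp del: of_nat_Suc)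
  qed
  then show ?thesis
    unfolding dirichlet_sum_def [abs_def]
    by (intro uniformly_continuous_on_sum bounded_linear.uniformly_continuous_on [OF bounded_linear_mult_right])
qed

lemma uniformly_continuous_on_uniform_limit:
  fixes f :: "'a \<Rightarrow> 'b::metric_space \<Rightarrow> 'c::metric_space"
  assumes lim: "uniform_limit S f g F" and uc: "\<And>n. uniformly_continuous_on S (f n)" and F: "F \<noteq> bot"
  shows "uniformly_continuous_on S g"
  unfolding uniformly_continuous_on_def
proof (intro allI impI)
  fix e :: real assume "0 < e"
  then obtain n where n: "\<And>x. x \<in> S \<Longrightarrow> dist (f n x) (g x) < e / 3"
    using eventually_happens' [OF F uniform_limitD [OF lim, of "e / 3"]] by auto
  obtain d where "0 < d" and d: "\<And>x x'. x \<in> S \<Longrightarrow> x' \<in> S \<Longrightarrow> dist x' x < d \<Longrightarrow> dist (f n x') (f n x) < e / 3"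
    using uc [of n] \<open>0 < e\<close> unfolding uniformly_continuous_on_def by (metis zero_less_divide_iff zero_less_numeral)
  have "dist (g x') (g x) < e" if "x \<in> S" "x' \<in> S" "dist x' x < d" for x x'
    using n [OF that(1)] n [OF that(2)] d [OF that] dist_triangle [of "g x'" "g x" "f n x"]
      dist_triangle [of "g x'" "f n x" "f n x'"] by (simp add: dist_commute)
  with \<open>0 < d\<close> show "\<exists>d>0. \<forall>x\<in>S. \<forall>x'\<in>S. dist x' x < d \<longrightarrow> dist (g x') (g x) < e" by blast
qed

lemma bohr_dirichlet_polynomial:
  assumes "\<And>n. L \<le> n \<Longrightarrow> b n = 0" "\<And>t. norm (dirichlet_sum b L (\<i> * of_real t)) \<le> M"
  assumes "0 < \<epsilon>" "\<epsilon> \<le> 1"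
  shows "norm (dirichlet_sum b N (\<i> * of_real \<tau>)) \<le> M * bohr_const \<epsilon> * real (Suc N) powr \<epsilon>"
proof (rule bohr_partial_sum_bound [where F = "\<lambda>t. dirichlet_sum b L (\<i> * of_real \<tau> + \<i> * of_real t)"
      and C = "\<Sum>n<L. norm (b n)" and \<theta> = 0])
  show "(\<lambda>N. dirichlet_sum b N (\<i> * of_real \<tau> + \<i> * of_real t))
      \<longlonglongrightarrow> dirichlet_sum b L (\<i> * of_real \<tau> + \<i> * of_real t)" for t
    by (rule tendsto_eventually, rule eventually_sequentiallyI [of L]) (rule dirichlet_sum_stable [OF assms(1)])
  show "norm (dirichlet_sum b L (\<i> * of_real \<tau> + \<i> * of_real t)) \<le> M" for t
    using assms(2) [of "\<tau> + t"] by (simp add: distrib_left)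
  show "norm (dirichlet_sum b N (\<i> * of_real \<tau> + \<i> * of_real t)) \<le> (\<Sum>n<L. norm (b n)) * (1 + \<bar>t\<bar>) powr 0" for N t
  proof -
    have "norm (dirichlet_sum b N (\<i> * of_real \<tau> + \<i> * of_real t)) \<le> (\<Sum>n<N. norm (b n))"
      by (rule norm_dirichlet_sum_le) simp
    also have "\<dots> = (\<Sum>n\<in>{..<N} \<inter> {..<L}. norm (b n))"
      using assms(1) by (intro sum.mono_neutral_right) (auto simp: not_less [symmetric])
    also have "\<dots> \<le> (\<Sum>n<L. norm (b n))"
      by (intro sum_mono2) auto
    finally show ?thesis by simp
  qed
qed (use assms in auto)

text \<open>
  By the maximum principle the approximating polynomials are uniformly Cauchy on the closed half-plane,
  so they have a uniformly continuous limit \<open>f\<close> there, which agrees with \<open>\<phi>\<close> on the boundary. Bohr's estimate for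
  differences of the polynomials shows that their coefficients converge, and survives the passage to
  the limit coefficients \<open>a\<close>. Summation by parts then shows that the Dirichlet series of \<open>a\<close> converges
  in the open half-plane and that its sum is the limit of the polynomials.
\<close>

lemma uniform_limit_imp_boundary_value:
  assumes "\<phi> \<in> X_imaginary_axis"
  obtains f where "f \<in> A_right_half_plane"
    "\<And>\<tau>::real. ((\<lambda>\<sigma>::real. f (of_real \<sigma> + \<i> * of_real \<tau>)) \<longlongrightarrow> \<phi> (\<i> * of_real \<tau>)) (at_right 0)"
proof -
  let ?H = "{s. 0 \<le> Re s}"
  obtain P where P: "\<And>k. dirichlet_polynomial (P k)" and lim: "uniform_limit imaginary_axis P \<phi> sequentially"
    using assms by (auto simp: X_imaginary_axis_def)
  have "\<forall>k. \<exists>b L. (\<forall>n\<ge>L. b n = 0) \<and> P k = dirichlet_sum b L"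
  proof
    fix k
    obtain b L where bL: "P k = dirichlet_sum b L" using P dirichlet_polynomial_iff by blast
    have "dirichlet_sum b L = dirichlet_sum (\<lambda>n. if n < L then b n else 0) L"
      by (simp add: dirichlet_sum_def fun_eq_iff)
    with bL show "\<exists>b L. (\<forall>n\<ge>L. b n = 0) \<and> P k = dirichlet_sum b L"
      by (intro exI [of _ "\<lambda>n. if n < L then b n else 0"] exI [of _ L]) auto
  qed
  then obtain c L where c0: "\<And>k n. L k \<le> n \<Longrightarrow> c k n = 0" and PL: "\<And>k. P k = dirichlet_sum (c k) (L k)"
    by metis
  let ?c = "\<lambda>j k n. c j n - c k n"
  have PN: "P k s = dirichlet_sum (c k) N s" if "L k \<le> N" for k N s
    using dirichlet_sum_stable [OF c0 that] PL by simp
  have diff: "P j s - P k s = dirichlet_sum (?c j k) (max (L j) (L k)) s" for j k s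
    by (simp add: dirichlet_sum_diff PN [of j "max (L j) (L k)"] PN [of k "max (L j) (L k)"])
  have Cauchy: "\<exists>m. \<forall>j\<ge>m. \<forall>k\<ge>m. \<forall>t. norm (P j (\<i> * of_real t) - P k (\<i> * of_real t)) \<le> e" if e: "0 < e" for e
  proof -
    have "uniformly_Cauchy_on imaginary_axis P"
      using lim uniformly_convergent_eq_Cauchy uniformly_convergent_on_def by blast
    then obtain m where "\<forall>x\<in>imaginary_axis. \<forall>j\<ge>m. \<forall>k\<ge>m. dist (P j x) (P k x) < e"
      using e unfolding uniformly_Cauchy_on_def by blast
    then show ?thesis
      by (intro exI [of _ m]) (auto simp: dist_norm imaginary_axis_def intro: less_imp_le)
  qed
  have Cauchy_H: "\<exists>m. \<forall>j\<ge>m. \<forall>k\<ge>m. \<forall>s. 0 \<le> Re s \<longrightarrow> norm (P j s - P k s) \<le> e" if "0 < e" for e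
    using Cauchy [OF that] unfolding diff by (meson dirichlet_sum_maximum_principle)
  have "uniformly_Cauchy_on ?H P"
    unfolding uniformly_Cauchy_on_def
  proof (intro allI impI)
    fix e :: real assume "0 < e"
    then obtain m where "\<forall>j\<ge>m. \<forall>k\<ge>m. \<forall>s. 0 \<le> Re s \<longrightarrow> norm (P j s - P k s) \<le> e / 2"
      using Cauchy_H [of "e / 2"] by auto
    with \<open>0 < e\<close> show "\<exists>M. \<forall>x\<in>?H. \<forall>m\<ge>M. \<forall>n\<ge>M. dist (P m x) (P n x) < e"
      by (intro exI [of _ m]) (fastforce simp: dist_norm)
  qed
  then obtain f where f: "uniform_limit ?H P f sequentially"
    using uniformly_convergent_eq_Cauchy uniformly_convergent_on_def by blast
  have f_lim: "(\<lambda>k. P k s) \<longlonglongrightarrow> f s" if "0 \<le> Re s" for s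
    using tendsto_uniform_limitI [OF f] that by simp
  have uc: "uniformly_continuous_on ?H f"
    by (rule uniformly_continuous_on_uniform_limit [OF f]) (auto simp: PL uniformly_continuous_dirichlet_sum)
  have f_axis: "f (\<i> * of_real t) = \<phi> (\<i> * of_real t)" for t
  proof (rule LIMSEQ_unique)
    show "(\<lambda>k. P k (\<i> * of_real t)) \<longlonglongrightarrow> \<phi> (\<i> * of_real t)"
      by (rule tendsto_uniform_limitI [OF lim]) (simp add: imaginary_axis_def)
  qed (simp add: f_lim)
  have bohr: "\<exists>m. \<forall>j\<ge>m. \<forall>k\<ge>m. \<forall>N t.
      norm (dirichlet_sum (?c j k) N (\<i> * of_real t)) \<le> e * bohr_const \<epsilon> * real (Suc N) powr \<epsilon>"
    if "0 < e" "0 < \<epsilon>" "\<epsilon> \<le> 1" for e \<epsilon>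
  proof -
    obtain m where m: "\<forall>j\<ge>m. \<forall>k\<ge>m. \<forall>t. norm (P j (\<i> * of_real t) - P k (\<i> * of_real t)) \<le> e"
      using Cauchy [OF \<open>0 < e\<close>] by blast
    show ?thesis
      by (intro exI [of _ m] allI impI bohr_dirichlet_polynomial [where L = "max (L _) (L _)"])
        (use m c0 that in \<open>auto simp: diff\<close>)
  qed
  have "Cauchy (\<lambda>k. c k n)" for n
  proof (rule metric_CauchyI)
    fix e :: real assume e: "0 < e"
    let ?K = "bohr_const 1 * (real (Suc n) powr 1 + real (Suc (Suc n)) powr 1) + 1"
    have K: "0 < ?K" using bohr_const_nonneg [of 1] by (intro add_nonneg_pos mult_nonneg_nonneg) auto
    obtain m where m: "\<And>j k N t. m \<le> j \<Longrightarrow> m \<le> k \<Longrightarrow>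
        norm (dirichlet_sum (?c j k) N (\<i> * of_real t)) \<le> e / ?K * bohr_const 1 * real (Suc N) powr 1"
      using bohr [OF divide_pos_pos [OF e K] zero_less_one order_refl] by blast
    have "dist (c j n) (c k n) < e" if "m \<le> j" "m \<le> k" for j k
    proof -
      \<comment> \<open>A coefficient is the difference of two consecutive partial sums at 0.\<close>
      have "?c j k n = dirichlet_sum (?c j k) (Suc n) 0 - dirichlet_sum (?c j k) n 0"
        by (simp add: dirichlet_sum_Suc)
      then have "norm (?c j k n) \<le> e / ?K * bohr_const 1 * real (Suc (Suc n)) powr 1 + e / ?K * bohr_const 1 * real (Suc n) powr 1"
        using m [OF that, of "Suc n" 0] m [OF that, of n 0]
          norm_triangle_ineq4 [of "dirichlet_sum (?c j k) (Suc n) 0" "dirichlet_sum (?c j k) n 0"] by simp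
      also have "\<dots> = e / ?K * (?K - 1)"
      proof -
        have "q * r * y + q * r * x = q * (r * (x + y) + 1 - 1)" for q r x y :: real
          by (simp add: algebra_simps)
        then show ?thesis .
      qed
      also have "\<dots> < e / ?K * ?K" using e K by (intro mult_strict_left_mono divide_pos_pos) auto
      also have "\<dots> = e" using K by simp
      finally show ?thesis by (simp add: dist_norm)
    qed
    then show "\<exists>M. \<forall>m\<ge>M. \<forall>n'\<ge>M. dist (c m n) (c n' n) < e" by (intro exI [of _ m]) simp
  qed
  then have "convergent (\<lambda>k. c k n)" for n
    by (rule Cauchy_convergent)
  moreover define a where "a n = lim (\<lambda>k. c k n)" for n
  ultimately have a: "(\<lambda>k. c k n) \<longlonglongrightarrow> a n" for n
    by (simp add: convergent_LIMSEQ_iff)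
  have bohr_a: "\<exists>m. \<forall>j\<ge>m. \<forall>N t.
      norm (dirichlet_sum (\<lambda>n. c j n - a n) N (\<i> * of_real t)) \<le> e * bohr_const \<epsilon> * real (Suc N) powr \<epsilon>"
    if e: "0 < e" "0 < \<epsilon>" "\<epsilon> \<le> 1" for e \<epsilon>
  proof -
    obtain m where m: "\<And>j k N t. m \<le> j \<Longrightarrow> m \<le> k \<Longrightarrow>
        norm (dirichlet_sum (?c j k) N (\<i> * of_real t)) \<le> e * bohr_const \<epsilon> * real (Suc N) powr \<epsilon>"
      using bohr [OF e] by blast
    show ?thesis
    proof (intro exI [of _ m] allI impI)
      fix j N t assume "m \<le> j"
      have "(\<lambda>k. norm (dirichlet_sum (?c j k) N (\<i> * of_real t)))
          \<longlonglongrightarrow> norm (dirichlet_sum (\<lambda>n. c j n - a n) N (\<i> * of_real t))"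
        unfolding dirichlet_sum_def by (intro tendsto_intros a)
      then show "norm (dirichlet_sum (\<lambda>n. c j n - a n) N (\<i> * of_real t)) \<le> e * bohr_const \<epsilon> * real (Suc N) powr \<epsilon>"
        by (rule tendsto_upperbound) (rule eventually_sequentiallyI [of m], rule m [OF \<open>m \<le> j\<close>], auto)
    qed
  qed
  have "(\<lambda>N. dirichlet_sum a N s) \<longlonglongrightarrow> f s" if s: "0 < Re s" for s
  proof -
    define \<epsilon> where "\<epsilon> = min 1 (Re s / 2)"
    have \<epsilon>: "0 < \<epsilon>" "\<epsilon> \<le> 1" "\<epsilon> < Re s" using s by (auto simp: \<epsilon>_def min_def)
    obtain \<rho> :: "nat \<Rightarrow> real" where
      \<rho>: "\<And>b s' M. (\<And>n. norm (dirichlet_sum b n s') \<le> M * real (Suc n) powr \<epsilon>) \<Longrightarrow>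
       \<exists>l. (\<lambda>N. dirichlet_sum b N (s' + of_real (Re s))) \<longlonglongrightarrow> l \<and>
           (\<forall>N. norm (dirichlet_sum b N (s' + of_real (Re s)) - l) \<le> M * \<rho> N)"
      using uniform_tail_bound [of \<epsilon> "Re s"] \<epsilon> less_imp_le by metis
    have s_eq: "\<i> * of_real (Im s) + of_real (Re s) = s"
      by (simp add: complex_eq_iff)
    have limP: "(\<lambda>N. dirichlet_sum (c j) N s) \<longlonglongrightarrow> P j s" for j
      by (rule tendsto_eventually, rule eventually_sequentiallyI [of "L j"]) (simp add: PN)
    have step: "\<exists>m. \<forall>j\<ge>m. \<exists>V. (\<lambda>N. dirichlet_sum a N s) \<longlonglongrightarrow> V \<and> norm (P j s - V) \<le> e * bohr_const \<epsilon> * \<rho> 0"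
      if e: "0 < e" for e
    proof -
      obtain m where m: "\<And>j N. m \<le> j \<Longrightarrow>
        norm (dirichlet_sum (\<lambda>n. c j n - a n) N (\<i> * of_real (Im s))) \<le> e * bohr_const \<epsilon> * real (Suc N) powr \<epsilon>"
        using bohr_a [OF e \<epsilon>(1,2)] by blast
      show ?thesis
      proof (intro exI [of _ m] allI impI)
        fix j assume "m \<le> j"
        obtain l where l: "(\<lambda>N. dirichlet_sum (\<lambda>n. c j n - a n) N s) \<longlonglongrightarrow> l"
          "norm (dirichlet_sum (\<lambda>n. c j n - a n) 0 s - l) \<le> e * bohr_const \<epsilon> * \<rho> 0"
          using \<rho> [OF m [OF \<open>m \<le> j\<close>]] unfolding s_eq by blast
        have "(\<lambda>N. dirichlet_sum a N s) \<longlonglongrightarrow> P j s - l"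
          using tendsto_diff [OF limP [of j] l(1)] by (simp add: dirichlet_sum_diff)
        with l(2) show "\<exists>V. (\<lambda>N. dirichlet_sum a N s) \<longlonglongrightarrow> V \<and> norm (P j s - V) \<le> e * bohr_const \<epsilon> * \<rho> 0"
          by (intro exI [of _ "P j s - l"]) simp
      qed
    qed
    obtain V where V: "(\<lambda>N. dirichlet_sum a N s) \<longlonglongrightarrow> V"
      using step [of 1] by auto
    have "(\<lambda>j. P j s) \<longlonglongrightarrow> V"
    proof (rule LIMSEQ_I)
      fix e :: real assume e: "0 < e"
      define K where "K = bohr_const \<epsilon> * \<bar>\<rho> 0\<bar> + 1"
      have K: "0 < K" unfolding K_def using bohr_const_nonneg [OF \<epsilon>(1)] by (intro add_nonneg_pos) auto
      obtain m where m: "\<And>j. m \<le> j \<Longrightarrow> norm (P j s - V) \<le> e / K * bohr_const \<epsilon> * \<rho> 0"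
        using step [of "e / K"] e K V LIMSEQ_unique by (metis divide_pos_pos)
      have "e / K * bohr_const \<epsilon> * \<rho> 0 \<le> e / K * (bohr_const \<epsilon> * \<bar>\<rho> 0\<bar>)"
        unfolding mult.assoc using e K bohr_const_nonneg [OF \<epsilon>(1)] by (intro mult_left_mono) auto
      also have "\<dots> < e / K * K"
        using e K by (intro mult_strict_left_mono) (auto simp: K_def)
      finally show "\<exists>m. \<forall>j\<ge>m. norm (P j s - V) < e"
        using m K by (intro exI [of _ m]) (auto intro: le_less_trans)
    qed
    then have "V = f s"
      using f_lim [of s] s LIMSEQ_unique by auto
    with V show ?thesis by simp
  qed
  then have "f \<in> A_right_half_plane"
    unfolding A_right_half_plane_iff
  proof (intro conjI exI allI impI)
    show "uniformly_continuous_on {s. 0 < Re s} f"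
      using uc unfolding uniformly_continuous_on_def by fastforce
  qed
  moreover have "((\<lambda>\<sigma>::real. f (of_real \<sigma> + \<i> * of_real \<tau>)) \<longlongrightarrow> \<phi> (\<i> * of_real \<tau>)) (at_right 0)" for \<tau>
  proof -
    have "continuous_on {0..} (\<lambda>\<sigma>::real. f (of_real \<sigma> + \<i> * of_real \<tau>))"
      by (rule continuous_on_compose2 [OF uniformly_continuous_imp_continuous [OF uc]])
        (auto intro!: continuous_intros)
    then have "((\<lambda>\<sigma>::real. f (of_real \<sigma> + \<i> * of_real \<tau>)) \<longlongrightarrow> f (of_real 0 + \<i> * of_real \<tau>)) (at 0 within {0..})"
      unfolding continuous_on_def by (rule bspec) simp
    then show ?thesis
      unfolding of_real_0 add_0 f_axis by (rule tendsto_within_subset) auto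
  qed
  ultimately show thesis using that by blast
qed

section \<open>From boundary values to uniform limits\<close>

lemma convergent_dirichlet_sum_bounded:
  assumes "(\<lambda>N. dirichlet_sum b N s) \<longlonglongrightarrow> l"
  obtains M where "\<And>N. norm (dirichlet_sum b N s) \<le> M"
  using convergent_imp_Bseq [OF convergentI [OF assms]] unfolding Bseq_def by blast

text \<open>
  On the line \<open>Re s = 2\<close> the series converges absolutely and is bounded. From any point of the strip this
  line is reached by a number of horizontal steps that depends only on the modulus of continuity, and
  each step changes the function by less than 1.
\<close>

lemma A_right_half_plane_bounded:
  assumes lim: "\<And>s. 0 < Re s \<Longrightarrow> (\<lambda>N. dirichlet_sum b N s) \<longlonglongrightarrow> f s"
    and uc: "uniformly_continuous_on {s. 0 < Re s} f"
  obtains M where "\<And>s. 0 < Re s \<Longrightarrow> Re s \<le> 2 \<Longrightarrow> norm (f s) \<le> M"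
proof -
  \<comment> \<open>The shift by \<open>s - 1/2\<close> has real part 3/2, so the exponent \<open>\<theta> = 0\<close> is admissible.\<close>
  obtain M0 where M0: "\<And>N. norm (dirichlet_sum b N (1/2)) \<le> M0"
  proof (rule convergent_dirichlet_sum_bounded)
    show "(\<lambda>N. dirichlet_sum b N (1/2)) \<longlonglongrightarrow> f (1/2)" by (rule lim) simp
  qed blast
  define K where "K = M0 * (1 + 4 * (\<Sum>n. real (Suc n) powr (- (3/2))))"
  have K: "norm (f s) \<le> K" if "Re s = 2" for s
  proof (rule tendsto_upperbound)
    show "(\<lambda>N. norm (dirichlet_sum b N s)) \<longlonglongrightarrow> norm (f s)"
      using that by (intro tendsto_norm lim) simp
    have "norm (dirichlet_sum b N s) \<le> K" for N
    proof -
      have "s - 1/2 \<noteq> 0" using that by (auto simp: complex_eq_iff)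
      then show ?thesis
        using dirichlet_sum_bound_shift [of b "1/2" M0 "s - 1/2" 0 N, OF M0] that by (simp add: K_def)
    qed
    then show "\<forall>\<^sub>F N in sequentially. norm (dirichlet_sum b N s) \<le> K" by simp
  qed simp
  obtain d where d: "0 < d" and ud: "\<And>x x'. 0 < Re x \<Longrightarrow> 0 < Re x' \<Longrightarrow> norm (x' - x) < d \<Longrightarrow> norm (f x' - f x) < 1"
  proof -
    have "\<exists>d>0. \<forall>x\<in>{s. 0 < Re s}. \<forall>x'\<in>{s. 0 < Re s}. norm (x' - x) < d \<longrightarrow> norm (f x' - f x) < 1"
      by (rule uc [unfolded uniformly_continuous_on_def dist_norm, THEN spec, THEN mp, OF zero_less_one])
    then show thesis using that by auto
  qed
  obtain m :: nat where m: "2 / d < real m"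
    using reals_Archimedean2 by blast
  have m0: "0 < m" using m d by (cases m) (auto simp: divide_less_0_iff)
  have "norm (f s) \<le> K + real m" if s: "0 < Re s" "Re s \<le> 2" for s
  proof -
    define h where "h = (2 - Re s) / real m"
    have h: "0 \<le> h" "h < d"
    proof -
      show "0 \<le> h" using s by (simp add: h_def)
      have "h \<le> 2 / real m" unfolding h_def using s by (intro divide_right_mono) auto
      also have "\<dots> < d" using m m0 d by (simp add: divide_simps mult.commute split: if_splits)
      finally show "h < d" .
    qed
    define g where "g j = f (s + of_real (real j * h))" for j
    have step: "norm (g (Suc j) - g j) \<le> 1" for j
      unfolding g_def
    proof (intro less_imp_le ud)
      have "s + of_real (real (Suc j) * h) - (s + of_real (real j * h)) = of_real h"
        by (simp add: algebra_simps)
      then show "norm (s + of_real (real (Suc j) * h) - (s + of_real (real j * h))) < d"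
        using h by (simp only: norm_of_real)
    qed (use s h in \<open>auto intro!: add_pos_nonneg\<close>)
    have "norm (g m - g 0) = norm (\<Sum>j<m. g (Suc j) - g j)"
      by (simp only: sum_lessThan_telescope)
    also have "\<dots> \<le> (\<Sum>j<m. 1)" by (rule sum_norm_le) (rule step)
    finally have "norm (g m - g 0) \<le> real m" by simp
    moreover have "norm (g m) \<le> K"
      unfolding g_def by (rule K) (use m0 in \<open>simp add: h_def\<close>)
    moreover have "norm (g 0) \<le> norm (g m) + norm (g m - g 0)"
      using norm_triangle_ineq4 [of "g m" "g m - g 0"] by simp
    moreover have "g 0 = f s" by (simp add: g_def)
    ultimately show ?thesis by simp
  qed
  then show thesis using that by blast
qed

text \<open>
  Convergence at the single real point \<open>c / 2\<close> already controls the partial sums on the whole line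
  \<open>Re s = c\<close>. The exponent \<open>1 - c / 4\<close> lies between \<open>1 - c / 2\<close>, where the majorant series would
  diverge, and 1, where the growth would no longer be sublinear.
\<close>

lemma dirichlet_sum_growth:
  assumes lim: "(\<lambda>N. dirichlet_sum b N (of_real (c / 2))) \<longlonglongrightarrow> l" and c: "0 < c" "c \<le> 2"
  obtains C where "\<And>N t. norm (dirichlet_sum b N (of_real c + \<i> * of_real t)) \<le> C * (1 + \<bar>t\<bar>) powr (1 - c / 4)"
proof -
  obtain M where M: "\<And>N. norm (dirichlet_sum b N (of_real (c / 2))) \<le> M"
    using lim by (rule convergent_dirichlet_sum_bounded) blast
  have M0: "0 \<le> M" using order_trans [OF norm_ge_zero M] .
  define Z where "Z = (\<Sum>n. real (Suc n) powr (- (c / 2) - (1 - c / 4)))"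
  have Z: "0 \<le> Z" unfolding Z_def using c by (intro suminf_nonneg summable_Suc_powr) auto
  have "norm (dirichlet_sum b N (of_real c + \<i> * of_real t)) \<le> M * (1 + 4 * Z) * (1 + \<bar>t\<bar>) powr (1 - c / 4)" for N t
  proof -
    define w where "w = of_real (c / 2) + \<i> * of_real t"
    have w: "Re w = c / 2" "norm w \<le> 1 + \<bar>t\<bar>"
      using norm_triangle_ineq [of "of_real (c / 2)" "\<i> * of_real t"] c by (auto simp: w_def norm_mult)
    have eq: "of_real c + \<i> * of_real t = of_real (c / 2) + w"
      by (simp add: w_def complex_eq_iff)
    have "norm (dirichlet_sum b N (of_real (c / 2) + w)) \<le> M * (1 + 4 * norm w powr (1 - c / 4) * Z)"
      using dirichlet_sum_bound_shift [of b "of_real (c / 2)" M w "1 - c / 4" N, OF M] w c by (simp add: Z_def)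
    also have "\<dots> \<le> M * (1 * (1 + \<bar>t\<bar>) powr (1 - c / 4) + 4 * (1 + \<bar>t\<bar>) powr (1 - c / 4) * Z)"
      using M0 Z w c by (intro mult_left_mono add_mono mult_right_mono powr_mono2) (auto intro!: ge_one_powr_ge_zero)
    also have "\<dots> = M * (1 + 4 * Z) * (1 + \<bar>t\<bar>) powr (1 - c / 4)"
      by (simp add: algebra_simps)
    finally show ?thesis unfolding eq .
  qed
  then show thesis using that by blast
qed

text \<open>
  Bohr's theorem: boundedness upgrades pointwise to uniform convergence. The distance from the boundary
  is used twice, once for the growth bound on \<open>Re s = c\<close> and once for the tail bound on \<open>Re s = 2 c\<close>.
\<close>

lemma uniform_convergence_vertical_line:
  assumes lim: "\<And>s. 0 < Re s \<Longrightarrow> (\<lambda>N. dirichlet_sum b N s) \<longlonglongrightarrow> f s"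
    and bound: "\<And>s. 0 < Re s \<Longrightarrow> Re s \<le> 2 \<Longrightarrow> norm (f s) \<le> M"
    and c: "0 < c" "c \<le> 1" and e: "0 < e"
  obtains N where "\<And>\<tau>. norm (dirichlet_sum b N (of_real (2 * c) + \<i> * of_real \<tau>) - f (of_real (2 * c) + \<i> * of_real \<tau>)) < e"
proof -
  define \<epsilon> where "\<epsilon> = c / 2"
  have \<epsilon>: "0 < \<epsilon>" "\<epsilon> \<le> 1" "0 \<le> \<epsilon>" "\<epsilon> < c" using c by (auto simp: \<epsilon>_def)
  obtain C where C: "\<And>N t. norm (dirichlet_sum b N (of_real c + \<i> * of_real t)) \<le> C * (1 + \<bar>t\<bar>) powr (1 - c / 4)"
    using dirichlet_sum_growth [of b c, OF lim] c by auto
  have C0: "0 \<le> C" using order_trans [OF norm_ge_zero C [of 0 0]] by simp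
  have bohr: "norm (dirichlet_sum b N (of_real c + \<i> * of_real \<tau>)) \<le> M * bohr_const \<epsilon> * real (Suc N) powr \<epsilon>" for N \<tau>
  proof (rule bohr_partial_sum_bound [where F = "\<lambda>t. f (of_real c + \<i> * of_real \<tau> + \<i> * of_real t)"
        and C = "C * (1 + \<bar>\<tau>\<bar>) powr (1 - c / 4)" and \<theta> = "1 - c / 4"])
    show "norm (dirichlet_sum b N (of_real c + \<i> * of_real \<tau> + \<i> * of_real t))
        \<le> C * (1 + \<bar>\<tau>\<bar>) powr (1 - c / 4) * (1 + \<bar>t\<bar>) powr (1 - c / 4)" for N t
    proof -
      have "norm (dirichlet_sum b N (of_real c + \<i> * of_real \<tau> + \<i> * of_real t)) \<le> C * (1 + \<bar>\<tau> + t\<bar>) powr (1 - c / 4)"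
        using C [of N "\<tau> + t"] by (simp add: algebra_simps)
      also have "\<dots> \<le> C * ((1 + \<bar>\<tau>\<bar>) * (1 + \<bar>t\<bar>)) powr (1 - c / 4)"
      proof (intro mult_left_mono powr_mono2)
        have "1 + \<bar>\<tau> + t\<bar> \<le> 1 + \<bar>\<tau>\<bar> + \<bar>t\<bar> + \<bar>\<tau>\<bar> * \<bar>t\<bar>" using abs_triangle_ineq [of \<tau> t] mult_nonneg_nonneg [of "\<bar>\<tau>\<bar>" "\<bar>t\<bar>"] by linarith
        then show "1 + \<bar>\<tau> + t\<bar> \<le> (1 + \<bar>\<tau>\<bar>) * (1 + \<bar>t\<bar>)" by (simp add: algebra_simps)
      qed (use C0 c in auto)
      finally show ?thesis by (simp add: powr_mult)
    qed
  qed (use c \<epsilon> in \<open>auto intro!: lim bound\<close>)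
  obtain \<rho> :: "nat \<Rightarrow> real" where \<rho>0: "\<rho> \<longlonglongrightarrow> 0" and
    \<rho>: "\<And>b s M. (\<And>n. norm (dirichlet_sum b n s) \<le> M * real (Suc n) powr \<epsilon>) \<Longrightarrow>
       \<exists>l. (\<lambda>N. dirichlet_sum b N (s + of_real c)) \<longlonglongrightarrow> l \<and>
           (\<forall>N. norm (dirichlet_sum b N (s + of_real c) - l) \<le> M * \<rho> N)"
    using uniform_tail_bound [OF \<epsilon>(3,2,4)] by metis
  have tail: "norm (dirichlet_sum b N (of_real (2 * c) + \<i> * of_real \<tau>) - f (of_real (2 * c) + \<i> * of_real \<tau>))
      \<le> M * bohr_const \<epsilon> * \<rho> N" for N \<tau>
  proof -
    have eq: "of_real c + \<i> * of_real \<tau> + of_real c = of_real (2 * c) + \<i> * of_real \<tau>" by simp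
    obtain l where l: "(\<lambda>N. dirichlet_sum b N (of_real (2 * c) + \<i> * of_real \<tau>)) \<longlonglongrightarrow> l"
      "norm (dirichlet_sum b N (of_real (2 * c) + \<i> * of_real \<tau>) - l) \<le> M * bohr_const \<epsilon> * \<rho> N"
      using \<rho> [OF bohr [of _ \<tau>]] unfolding eq by blast
    moreover have "l = f (of_real (2 * c) + \<i> * of_real \<tau>)"
      using l(1) c by (intro LIMSEQ_unique [OF _ lim]) auto
    ultimately show ?thesis by simp
  qed
  have "(\<lambda>N. M * bohr_const \<epsilon> * \<rho> N) \<longlonglongrightarrow> 0"
    by (rule tendsto_mult_right_zero [OF \<rho>0])
  then have "\<forall>\<^sub>F N in sequentially. M * bohr_const \<epsilon> * \<rho> N < e"
    using e by (rule order_tendstoD)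
  then obtain N where "M * bohr_const \<epsilon> * \<rho> N < e"
    using eventually_happens' [OF sequentially_bot] by blast
  then show thesis using that tail le_less_trans by blast
qed

text \<open>
  Uniform continuity makes \<open>f (\<sigma> + i \<tau>)\<close> converge to \<open>\<phi> (i \<tau>)\<close> uniformly in \<open>\<tau>\<close>, and on each line \<open>Re s = \<sigma>\<close>
  some partial sum is uniformly close to \<open>f\<close>. A partial sum with its argument shifted by \<open>\<sigma>\<close> is
  again a Dirichlet polynomial.
\<close>

lemma boundary_value_imp_uniform_limit:
  assumes f: "f \<in> A_right_half_plane"
    and boundary: "\<And>\<tau>::real. ((\<lambda>\<sigma>::real. f (of_real \<sigma> + \<i> * of_real \<tau>)) \<longlongrightarrow> \<phi> (\<i> * of_real \<tau>)) (at_right 0)"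
  shows "\<phi> \<in> X_imaginary_axis"
proof -
  obtain b where lim: "\<And>s. 0 < Re s \<Longrightarrow> (\<lambda>N. dirichlet_sum b N s) \<longlonglongrightarrow> f s"
    and uc: "uniformly_continuous_on {s. 0 < Re s} f"
    using f unfolding A_right_half_plane_iff by blast
  obtain M where M: "\<And>s. 0 < Re s \<Longrightarrow> Re s \<le> 2 \<Longrightarrow> norm (f s) \<le> M"
    using A_right_half_plane_bounded [OF lim uc] by blast
  define c where "c k = 1 / real (Suc k)" for k
  have c: "0 < c k" "c k \<le> 1" for k by (auto simp: c_def divide_simps)
  have c0: "c \<longlonglongrightarrow> 0" unfolding c_def [abs_def] by (rule LIMSEQ_Suc [OF lim_1_over_n])
  have "\<exists>N. \<forall>\<tau>. norm (dirichlet_sum b N (of_real (2 * c k) + \<i> * of_real \<tau>) - f (of_real (2 * c k) + \<i> * of_real \<tau>)) < c k" for k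
    using uniform_convergence_vertical_line [OF lim M c c(1)] by metis
  then obtain L where L: "\<And>k \<tau>. norm (dirichlet_sum b (L k) (of_real (2 * c k) + \<i> * of_real \<tau>) - f (of_real (2 * c k) + \<i> * of_real \<tau>)) < c k"
    by metis
  define P where "P k s = dirichlet_sum b (L k) (of_real (2 * c k) + s)" for k s
  have "dirichlet_polynomial (P k)" for k
  proof -
    have "P k = dirichlet_sum (\<lambda>n. b n * inv_pow n (of_real (2 * c k))) (L k)"
      by (rule ext) (simp only: P_def dirichlet_sum_def inv_pow_add mult.assoc)
    then show ?thesis unfolding dirichlet_polynomial_iff by blast
  qed
  moreover have "uniform_limit imaginary_axis P \<phi> sequentially"
  proof (rule uniform_limitI)
    fix e :: real assume e: "0 < e"
    obtain d where d: "0 < d" and ud: "\<And>x x'. 0 < Re x \<Longrightarrow> 0 < Re x' \<Longrightarrow> norm (x' - x) < d \<Longrightarrow> norm (f x' - f x) < e / 2"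
      using uc e unfolding uniformly_continuous_on_def dist_norm by (auto dest!: spec [of _ "e / 2"])
    have near: "norm (f (of_real x + \<i> * of_real \<tau>) - \<phi> (\<i> * of_real \<tau>)) \<le> e / 2" if x: "0 < x" "x < d" for x \<tau>
    proof (rule tendsto_upperbound)
      show "((\<lambda>\<sigma>. norm (f (of_real x + \<i> * of_real \<tau>) - f (of_real \<sigma> + \<i> * of_real \<tau>)))
          \<longlongrightarrow> norm (f (of_real x + \<i> * of_real \<tau>) - \<phi> (\<i> * of_real \<tau>))) (at_right 0)"
        by (intro tendsto_intros boundary)
      have "\<forall>\<^sub>F \<sigma> in at_right (0::real). \<sigma> \<in> {0<..<x}"
        using x by (intro eventually_at_right_real)
      then show "\<forall>\<^sub>F \<sigma> in at_right 0. norm (f (of_real x + \<i> * of_real \<tau>) - f (of_real \<sigma> + \<i> * of_real \<tau>)) \<le> e / 2"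
      proof eventually_elim
        case (elim \<sigma>)
        have "of_real x + \<i> * of_real \<tau> - (of_real \<sigma> + \<i> * of_real \<tau>) = complex_of_real (x - \<sigma>)" by simp
        then have "norm (of_real x + \<i> * of_real \<tau> - (of_real \<sigma> + \<i> * of_real \<tau>)) < d"
          using elim x by (simp only: norm_of_real) simp
        then show ?case using elim x by (intro less_imp_le ud) auto
      qed
    qed simp
    have "(\<lambda>k. 2 * c k) \<longlonglongrightarrow> 0" using tendsto_mult_right_zero [OF c0] .
    then have "\<forall>\<^sub>F k in sequentially. 2 * c k < d"
      using d by (rule order_tendstoD)
    moreover have "\<forall>\<^sub>F k in sequentially. c k < e / 2"
      using e by (intro order_tendstoD(2) [OF c0]) simp
    ultimately show "\<forall>\<^sub>F k in sequentially. \<forall>s\<in>imaginary_axis. dist (P k s) (\<phi> s) < e"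
    proof eventually_elim
      case (elim k)
      show ?case
      proof
        fix s assume "s \<in> imaginary_axis"
        then obtain \<tau> where s: "s = \<i> * of_real \<tau>"
          by (metis (mono_tags) imaginary_axis_def mem_Collect_eq complex_eq_iff complex_eq add_0 of_real_0)
        have "norm (P k s - f (of_real (2 * c k) + s)) < e / 2"
          unfolding P_def s using L [of k \<tau>] elim by linarith
        moreover have "norm (f (of_real (2 * c k) + s) - \<phi> s) \<le> e / 2"
          unfolding s using elim c [of k] by (intro near) auto
        ultimately show "dist (P k s) (\<phi> s) < e"
          using norm_triangle_ineq [of "P k s - f (of_real (2 * c k) + s)" "f (of_real (2 * c k) + s) - \<phi> s"]
          by (simp add: dist_norm)
      qed
    qed
  qed
  ultimately show ?thesis unfolding X_imaginary_axis_def by blast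
qed

theorem mainTheorem13:
  fixes \<phi> :: "complex \<Rightarrow> complex"
  shows "\<phi> \<in> X_imaginary_axis \<longleftrightarrow>
    (\<exists>f\<in>A_right_half_plane. \<forall>\<tau>::real.
       ((\<lambda>\<sigma>::real. f (complex_of_real \<sigma> + \<i> * complex_of_real \<tau>))
          \<longlongrightarrow> \<phi> (\<i> * complex_of_real \<tau>)) (at_right 0))"
proof
  assume "\<phi> \<in> X_imaginary_axis"
  then show "\<exists>f\<in>A_right_half_plane. \<forall>\<tau>::real.
       ((\<lambda>\<sigma>::real. f (complex_of_real \<sigma> + \<i> * complex_of_real \<tau>))
          \<longlongrightarrow> \<phi> (\<i> * complex_of_real \<tau>)) (at_right 0)"
    by (rule uniform_limit_imp_boundary_value) blast
qed (blast intro: boundary_value_imp_uniform_limit)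

end
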